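(* Let $S$ be a completely regular semigroup. The following conditions are equivalent. (1) $S$ is orthodox; (2) $S$ is a semilattice of rectangular groups; (3) $\mathcal{D}\cap\mathcal{F}=\mathcal{D}\cap\tau$; (4) $\mathcal{D}\cap\mathcal{F}$ is a congruence on $S$; (5) $\mathcal{D}\cap\Theta=\mathcal{D}\cap\tau$; (6) $\mathcal{D}\cap\Theta$ is a congruence on $S$; (7) $\nu\subseteq\tau$; (8) $\nu\cap\mathcal{H}=\varepsilon$; (9) $\nu_k=\varepsilon$; (10) there exists an idempotent pure Clifford congruence on $S$; (11) $\nu\subseteq\mathcal{F}$; (12) $\nu$ is over rectangular bands; (13) $\nu\subseteq\mathcal{Y}$.
   Context: A completely regular semigroup is a semigroup that is a union of its subgroups; for $a\in S$, $a^{-1}$ is the inverse of $a$ in the maximal subgroup containing $a$, and $a^0=aa^{-1}=a^{-1}a$. $E(S)$ is the set of idempotents of $S$, $V(a)$ the set of all inverses of $a$ in $S$ (elements $x$ with $a=axa$, $x=xax$), $\mathcal{H}$ and $\mathcal{D}$ are Green's relations, and $\varepsilon$ is the equality relation. Relations on $S$: $a\,\mathcal{F}\,b\iff ab^{-1}\in E(S)$; $a\,\mathcal{Y}\,b\iff V(a)=V(b)$; $a\,\Theta\,b\iff a^0b=ab^0$. A regular semigroup is orthodox if its idempotents form a subsemigroup. A rectangular band is a semigroup satisfying $a=axa$; a rectangular group is a semigroup isomorphic to the direct product of a rectangular band and a group. $S$ is a semilattice of rectangular groups if there is a congruence on $S$ whose quotient is a semilattice (commutative band) and each of whose classes is a rectangular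 group. A Clifford semigroup is a completely regular semigroup whose idempotents are central; a Clifford congruence is one whose quotient is Clifford; $\nu$ is the least Clifford congruence on $S$. For a congruence $\rho$ on $S$: $\ker\rho=\{a\in S: a\,\rho\,e\text{ for some }e\in E(S)\}$ and $\rho_k$ is the least congruence on $S$ with the same kernel as $\rho$. A congruence $\rho$ is idempotent pure if $a\,\rho\,e$ with $a\in S$, $e\in E(S)$ implies $a\in E(S)$; $\tau$ is the greatest idempotent pure congruence on $S$. A congruence is over rectangular bands if each of its classes that is a subsemigroup of $S$ is a rectangular band. *)

theory Defs
  imports "HOL-Algebra.Group"
begin

section \<open>Semigroups on an explicit carrier\<close>

record 'a sgrp = "'a partial_object" +
  sg_mult :: "'a \<Rightarrow> 'a \<Rightarrow> 'a" (infixl \<open>\<cdot>\<index>\<close> 70)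

text \<open>As usual in semigroup theory, a semigroup is nonempty.\<close>

definition semigrp :: "'a sgrp \<Rightarrow> bool" where
  "semigrp S \<longleftrightarrow> carrier S \<noteq> {} \<and>
     (\<forall>a\<in>carrier S. \<forall>b\<in>carrier S. a \<cdot>\<^bsub>S\<^esub> b \<in> carrier S) \<and>
     (\<forall>a\<in>carrier S. \<forall>b\<in>carrier S. \<forall>c\<in>carrier S.
        (a \<cdot>\<^bsub>S\<^esub> b) \<cdot>\<^bsub>S\<^esub> c = a \<cdot>\<^bsub>S\<^esub> (b \<cdot>\<^bsub>S\<^esub> c))"

abbreviation restr :: "'a sgrp \<Rightarrow> 'a set \<Rightarrow> 'a sgrp" where
  "restr S T \<equiv> S\<lparr>carrier := T\<rparr>"

definition subsemigrp :: "'a sgrp \<Rightarrow> 'a set \<Rightarrow> bool" where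
  "subsemigrp S T \<longleftrightarrow> T \<subseteq> carrier S \<and> semigrp (restr S T)"

definition idems :: "'a sgrp \<Rightarrow> 'a set" where
  "idems S = {e \<in> carrier S. e \<cdot>\<^bsub>S\<^esub> e = e}"

text \<open>A structure with an identity element, viewed as a monoid record of the library.
  For structures without an identity the field \<open>one\<close> is unspecified.\<close>

definition monoid_of :: "'a sgrp \<Rightarrow> 'a monoid" where
  "monoid_of T = \<lparr>carrier = carrier T, mult = sg_mult T,
     one = (THE e. e \<in> carrier T \<and> (\<forall>x\<in>carrier T. e \<cdot>\<^bsub>T\<^esub> x = x \<and> x \<cdot>\<^bsub>T\<^esub> e = x))\<rparr>"

definition is_group :: "'a sgrp \<Rightarrow> bool" where
  "is_group T \<longleftrightarrow> group (monoid_of T)"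

definition sg_iso :: "('a \<Rightarrow> 'b) \<Rightarrow> 'a sgrp \<Rightarrow> 'b sgrp \<Rightarrow> bool" where
  "sg_iso f S T \<longleftrightarrow> bij_betw f (carrier S) (carrier T) \<and>
     (\<forall>a\<in>carrier S. \<forall>b\<in>carrier S. f (a \<cdot>\<^bsub>S\<^esub> b) = f a \<cdot>\<^bsub>T\<^esub> f b)"

definition dir_prod :: "'a sgrp \<Rightarrow> 'b sgrp \<Rightarrow> ('a \<times> 'b) sgrp" where
  "dir_prod S T = \<lparr>carrier = carrier S \<times> carrier T,
     sg_mult = (\<lambda>(a, b) (c, d). (a \<cdot>\<^bsub>S\<^esub> c, b \<cdot>\<^bsub>T\<^esub> d))\<rparr>"


section \<open>Classes of semigroups\<close>

definition regular_sg :: "'a sgrp \<Rightarrow> bool" where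
  "regular_sg S \<longleftrightarrow> semigrp S \<and>
     (\<forall>a\<in>carrier S. \<exists>x\<in>carrier S. a = a \<cdot>\<^bsub>S\<^esub> x \<cdot>\<^bsub>S\<^esub> a)"

definition orthodox :: "'a sgrp \<Rightarrow> bool" where
  "orthodox S \<longleftrightarrow> regular_sg S \<and> subsemigrp S (idems S)"

definition semilattice_sg :: "'a sgrp \<Rightarrow> bool" where
  "semilattice_sg S \<longleftrightarrow> semigrp S \<and> (\<forall>a\<in>carrier S. a \<cdot>\<^bsub>S\<^esub> a = a) \<and>
     (\<forall>a\<in>carrier S. \<forall>b\<in>carrier S. a \<cdot>\<^bsub>S\<^esub> b = b \<cdot>\<^bsub>S\<^esub> a)"

definition rectangular_band :: "'a sgrp \<Rightarrow> bool" where
  "rectangular_band S \<longleftrightarrow> semigrp S \<and>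
     (\<forall>a\<in>carrier S. \<forall>x\<in>carrier S. a = a \<cdot>\<^bsub>S\<^esub> x \<cdot>\<^bsub>S\<^esub> a)"

text \<open>Restricting both factors to the element type of \<open>S\<close> is no loss of generality, since each
  factor of a direct product of a rectangular band and a group embeds into the product; see
  \<open>rectangular_groupI\<close> below.\<close>

definition rectangular_group :: "'a sgrp \<Rightarrow> bool" where
  "rectangular_group S \<longleftrightarrow> semigrp S \<and>
     (\<exists>(B :: 'a sgrp) (G :: 'a sgrp) f.
        rectangular_band B \<and> is_group G \<and> sg_iso f S (dir_prod B G))"

definition subgroup_of :: "'a sgrp \<Rightarrow> 'a set \<Rightarrow> bool" where
  "subgroup_of S G \<longleftrightarrow> G \<subseteq> carrier S \<and> is_group (restr S G)"

definition maximal_subgroup :: "'a sgrp \<Rightarrow> 'a set \<Rightarrow> bool" where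
  "maximal_subgroup S G \<longleftrightarrow> subgroup_of S G \<and> (\<forall>K. subgroup_of S K \<and> G \<subseteq> K \<longrightarrow> K = G)"

definition completely_regular :: "'a sgrp \<Rightarrow> bool" where
  "completely_regular S \<longleftrightarrow> semigrp S \<and> carrier S = \<Union>{G. subgroup_of S G}"

definition clifford :: "'a sgrp \<Rightarrow> bool" where
  "clifford S \<longleftrightarrow> completely_regular S \<and>
     (\<forall>e\<in>idems S. \<forall>a\<in>carrier S. e \<cdot>\<^bsub>S\<^esub> a = a \<cdot>\<^bsub>S\<^esub> e)"


section \<open>Inverses and relations on a semigroup\<close>

text \<open>\<open>cr_inv S a\<close> is the inverse of \<open>a\<close> in the maximal subgroup containing \<open>a\<close>, which is unique
  if it exists.\<close>

definition cr_inv :: "'a sgrp \<Rightarrow> 'a \<Rightarrow> 'a" where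
  "cr_inv S a = inv\<^bsub>monoid_of (restr S (THE G. maximal_subgroup S G \<and> a \<in> G))\<^esub> a"

definition cr_zero :: "'a sgrp \<Rightarrow> 'a \<Rightarrow> 'a" where
  "cr_zero S a = a \<cdot>\<^bsub>S\<^esub> cr_inv S a"

definition inverses :: "'a sgrp \<Rightarrow> 'a \<Rightarrow> 'a set" where
  "inverses S a = {x \<in> carrier S. a = a \<cdot>\<^bsub>S\<^esub> x \<cdot>\<^bsub>S\<^esub> a \<and> x = x \<cdot>\<^bsub>S\<^esub> a \<cdot>\<^bsub>S\<^esub> x}"

definition eq_rel :: "'a sgrp \<Rightarrow> 'a rel" where
  "eq_rel S = Id_on (carrier S)"

definition green_L :: "'a sgrp \<Rightarrow> 'a rel" where
  "green_L S = {(a, b). a \<in> carrier S \<and> b \<in> carrier S \<and>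
     insert a ((\<lambda>s. s \<cdot>\<^bsub>S\<^esub> a) ` carrier S) = insert b ((\<lambda>s. s \<cdot>\<^bsub>S\<^esub> b) ` carrier S)}"

definition green_R :: "'a sgrp \<Rightarrow> 'a rel" where
  "green_R S = {(a, b). a \<in> carrier S \<and> b \<in> carrier S \<and>
     insert a ((\<lambda>s. a \<cdot>\<^bsub>S\<^esub> s) ` carrier S) = insert b ((\<lambda>s. b \<cdot>\<^bsub>S\<^esub> s) ` carrier S)}"

definition green_H :: "'a sgrp \<Rightarrow> 'a rel" where
  "green_H S = green_L S \<inter> green_R S"

definition green_D :: "'a sgrp \<Rightarrow> 'a rel" where
  "green_D S = green_L S O green_R S"

definition rel_F :: "'a sgrp \<Rightarrow> 'a rel" where
  "rel_F S = {(a, b). a \<in> carrier S \<and> b \<in> carrier S \<and> a \<cdot>\<^bsub>S\<^esub> cr_inv S b \<in> idems S}"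

definition rel_Y :: "'a sgrp \<Rightarrow> 'a rel" where
  "rel_Y S = {(a, b). a \<in> carrier S \<and> b \<in> carrier S \<and> inverses S a = inverses S b}"

definition rel_Theta :: "'a sgrp \<Rightarrow> 'a rel" where
  "rel_Theta S = {(a, b). a \<in> carrier S \<and> b \<in> carrier S \<and>
     cr_zero S a \<cdot>\<^bsub>S\<^esub> b = a \<cdot>\<^bsub>S\<^esub> cr_zero S b}"


section \<open>Congruences\<close>

definition sg_congruence :: "'a sgrp \<Rightarrow> 'a rel \<Rightarrow> bool" where
  "sg_congruence S \<rho> \<longleftrightarrow> equiv (carrier S) \<rho> \<and>
     (\<forall>a b c. (a, b) \<in> \<rho> \<and> c \<in> carrier S \<longrightarrow>
        (c \<cdot>\<^bsub>S\<^esub> a, c \<cdot>\<^bsub>S\<^esub> b) \<in> \<rho> \<and> (a \<cdot>\<^bsub>S\<^esub> c, b \<cdot>\<^bsub>S\<^esub> c) \<in> \<rho>)"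

text \<open>For a congruence, the union below is a single class, the product of the two given ones.\<close>

definition quotient_sg :: "'a sgrp \<Rightarrow> 'a rel \<Rightarrow> 'a set sgrp" where
  "quotient_sg S \<rho> = \<lparr>carrier = carrier S // \<rho>,
     sg_mult = (\<lambda>A B. \<Union>a\<in>A. \<Union>b\<in>B. \<rho> `` {a \<cdot>\<^bsub>S\<^esub> b})\<rparr>"

definition semilattice_of_rectangular_groups :: "'a sgrp \<Rightarrow> bool" where
  "semilattice_of_rectangular_groups S \<longleftrightarrow>
     (\<exists>\<rho>. sg_congruence S \<rho> \<and> semilattice_sg (quotient_sg S \<rho>) \<and>
        (\<forall>A \<in> carrier S // \<rho>. rectangular_group (restr S A)))"

definition clifford_congruence :: "'a sgrp \<Rightarrow> 'a rel \<Rightarrow> bool" where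
  "clifford_congruence S \<rho> \<longleftrightarrow> sg_congruence S \<rho> \<and> clifford (quotient_sg S \<rho>)"

definition idempotent_pure :: "'a sgrp \<Rightarrow> 'a rel \<Rightarrow> bool" where
  "idempotent_pure S \<rho> \<longleftrightarrow> sg_congruence S \<rho> \<and>
     (\<forall>a\<in>carrier S. \<forall>e\<in>idems S. (a, e) \<in> \<rho> \<longrightarrow> a \<in> idems S)"

definition over_rectangular_bands :: "'a sgrp \<Rightarrow> 'a rel \<Rightarrow> bool" where
  "over_rectangular_bands S \<rho> \<longleftrightarrow> sg_congruence S \<rho> \<and>
     (\<forall>A \<in> carrier S // \<rho>. subsemigrp S A \<longrightarrow> rectangular_band (restr S A))"

definition kernel_rel :: "'a sgrp \<Rightarrow> 'a rel \<Rightarrow> 'a set" where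
  "kernel_rel S \<rho> = {a \<in> carrier S. \<exists>e\<in>idems S. (a, e) \<in> \<rho>}"

text \<open>Least and greatest are meant with respect to inclusion of relations. On a completely
  regular semigroup the three congruences below exist.\<close>

definition nu :: "'a sgrp \<Rightarrow> 'a rel" where
  "nu S = (LEAST \<rho>. clifford_congruence S \<rho>)"

definition tau :: "'a sgrp \<Rightarrow> 'a rel" where
  "tau S = (GREATEST \<rho>. idempotent_pure S \<rho>)"

definition lower_k :: "'a sgrp \<Rightarrow> 'a rel \<Rightarrow> 'a rel" where
  "lower_k S \<rho> = (LEAST \<sigma>. sg_congruence S \<sigma> \<and> kernel_rel S \<sigma> = kernel_rel S \<rho>)"


section \<open>Independence of \<open>rectangular_group\<close> from the types of the factors\<close>

lemma is_group_iff:
  "is_group G \<longleftrightarrow> semigrp G \<and> (\<exists>e\<in>carrier G. (\<forall>x\<in>carrier G. e \<cdot>\<^bsub>G\<^esub> x = x \<and> x \<cdot>\<^bsub>G\<^esub> e = x) \<and>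
     (\<forall>x\<in>carrier G. \<exists>y\<in>carrier G. y \<cdot>\<^bsub>G\<^esub> x = e))" (is "?L \<longleftrightarrow> ?R")
proof
  assume ?L
  then interpret group "monoid_of G" unfolding is_group_def .
  have c: "carrier (monoid_of G) = carrier G" and m: "mult (monoid_of G) = sg_mult G"
    by (simp_all add: monoid_of_def)
  have "semigrp G"
    unfolding semigrp_def
    using m_closed m_assoc one_closed unfolding c m by (intro conjI ballI) auto
  moreover have "\<exists>y\<in>carrier G. y \<cdot>\<^bsub>G\<^esub> x = \<one>\<^bsub>monoid_of G\<^esub>" if "x \<in> carrier G" for x
    using l_inv_ex[of x] that unfolding c m by auto
  ultimately show ?R
    using one_closed l_one r_one unfolding c m by (intro conjI bexI[of _ "\<one>\<^bsub>monoid_of G\<^esub>"]) auto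
next
  assume R: ?R
  then obtain e where e: "e \<in> carrier G" "\<forall>x\<in>carrier G. e \<cdot>\<^bsub>G\<^esub> x = x \<and> x \<cdot>\<^bsub>G\<^esub> e = x"
    "\<forall>x\<in>carrier G. \<exists>y\<in>carrier G. y \<cdot>\<^bsub>G\<^esub> x = e" by blast
  have "(THE e. e \<in> carrier G \<and> (\<forall>x\<in>carrier G. e \<cdot>\<^bsub>G\<^esub> x = x \<and> x \<cdot>\<^bsub>G\<^esub> e = x)) = e"
  proof (rule the_equality)
    fix d assume "d \<in> carrier G \<and> (\<forall>x\<in>carrier G. d \<cdot>\<^bsub>G\<^esub> x = x \<and> x \<cdot>\<^bsub>G\<^esub> d = x)"
    then show "d = e" using e(1,2) by metis
  qed (use e in simp)
  then have M: "monoid_of G = \<lparr>carrier = carrier G, mult = sg_mult G, one = e\<rparr>"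
    by (simp add: monoid_of_def)
  show ?L unfolding is_group_def M
    using R e by (intro groupI) (auto simp: semigrp_def)
qed

lemma rectangular_groupI:
  fixes S :: "'a sgrp" and B :: "'b sgrp" and G :: "'c sgrp"
  assumes S: "semigrp S" and B: "rectangular_band B" and G: "is_group G"
    and f: "sg_iso f S (dir_prod B G)"
  shows "rectangular_group S"
proof -
  obtain e where e: "e \<in> carrier G" "\<And>x. x \<in> carrier G \<Longrightarrow> e \<cdot>\<^bsub>G\<^esub> x = x \<and> x \<cdot>\<^bsub>G\<^esub> e = x"
    "\<And>x. x \<in> carrier G \<Longrightarrow> \<exists>y\<in>carrier G. y \<cdot>\<^bsub>G\<^esub> x = e" and sG: "semigrp G"
    using G unfolding is_group_iff by blast
  have sB: "semigrp B" using B by (simp add: rectangular_band_def)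
  then obtain b where b: "b \<in> carrier B" by (auto simp: semigrp_def)
  define i where "i x = inv_into (carrier S) f (x, e)" for x
  define j where "j g = inv_into (carrier S) f (b, g)" for g
  have bij: "bij_betw f (carrier S) (carrier B \<times> carrier G)"
    using f by (simp add: sg_iso_def dir_prod_def)
  have fi: "i x \<in> carrier S" "f (i x) = (x, e)" if "x \<in> carrier B" for x
    using that e(1) bij unfolding i_def
    by (auto simp: bij_betw_def inv_into_into intro!: f_inv_into_f inv_into_into)
  have fj: "j g \<in> carrier S" "f (j g) = (b, g)" if "g \<in> carrier G" for g
    using that b bij unfolding j_def
    by (auto simp: bij_betw_def inv_into_into intro!: f_inv_into_f inv_into_into)
  define p where "p s = i (fst (f s))" for s
  define q where "q s = j (snd (f s))" for s
  define B' where "B' = \<lparr>carrier = i ` carrier B, sg_mult = (\<lambda>s t. i (fst (f s) \<cdot>\<^bsub>B\<^esub> fst (f t)))\<rparr>"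
  define G' where "G' = \<lparr>carrier = j ` carrier G, sg_mult = (\<lambda>s t. j (snd (f s) \<cdot>\<^bsub>G\<^esub> snd (f t)))\<rparr>"
  have "rectangular_band B'"
    unfolding rectangular_band_def
  proof
    show "semigrp B'" using sB unfolding semigrp_def B'_def by (simp add: fi)
    have "a \<cdot>\<^bsub>B\<^esub> x \<cdot>\<^bsub>B\<^esub> a = a" "a \<cdot>\<^bsub>B\<^esub> x \<in> carrier B" if "a \<in> carrier B" "x \<in> carrier B" for a x
      using B that by (auto simp: rectangular_band_def semigrp_def)
    then show "\<forall>a\<in>carrier B'. \<forall>x\<in>carrier B'. a = a \<cdot>\<^bsub>B'\<^esub> x \<cdot>\<^bsub>B'\<^esub> a"
      unfolding B'_def by (simp add: fi)
  qed
  moreover have "is_group G'"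
    unfolding is_group_iff
  proof (intro conjI bexI[of _ "j e"])
    show "semigrp G'" using sG unfolding semigrp_def G'_def by (simp add: fj)
    show "\<forall>x\<in>carrier G'. \<exists>y\<in>carrier G'. y \<cdot>\<^bsub>G'\<^esub> x = j e"
    proof
      fix x assume "x \<in> carrier G'"
      then obtain g where g: "g \<in> carrier G" "x = j g" by (auto simp: G'_def)
      obtain h where "h \<in> carrier G" "h \<cdot>\<^bsub>G\<^esub> g = e" using e(3)[OF g(1)] by blast
      then show "\<exists>y\<in>carrier G'. y \<cdot>\<^bsub>G'\<^esub> x = j e"
        using g by (intro bexI[of _ "j h"]) (auto simp: G'_def fj)
    qed
  qed (use e in \<open>auto simp: G'_def fj\<close>)
  moreover have "sg_iso (\<lambda>s. (p s, q s)) S (dir_prod B' G')"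
    unfolding sg_iso_def
  proof
    have "bij_betw i (carrier B) (i ` carrier B)" "bij_betw j (carrier G) (j ` carrier G)"
      using fi(2) fj(2) by (auto intro!: inj_on_imp_bij_betw inj_onI) (metis prod.inject)+
    then have "bij_betw (map_prod i j) (carrier B \<times> carrier G) (i ` carrier B \<times> j ` carrier G)"
      by (rule bij_betw_map_prod)
    from bij_betw_trans[OF bij this]
    show "bij_betw (\<lambda>s. (p s, q s)) (carrier S) (carrier (dir_prod B' G'))"
      by (simp add: dir_prod_def B'_def G'_def p_def q_def comp_def map_prod_def case_prod_beta)
    show "\<forall>s\<in>carrier S. \<forall>t\<in>carrier S.
        (p (s \<cdot>\<^bsub>S\<^esub> t), q (s \<cdot>\<^bsub>S\<^esub> t)) = (p s, q s) \<cdot>\<^bsub>dir_prod B' G'\<^esub> (p t, q t)"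
    proof (intro ballI)
      fix s t assume st: "s \<in> carrier S" "t \<in> carrier S"
      have m: "f (s \<cdot>\<^bsub>S\<^esub> t) = f s \<cdot>\<^bsub>dir_prod B G\<^esub> f t"
        using f st by (simp add: sg_iso_def)
      have "f s \<in> carrier B \<times> carrier G" "f t \<in> carrier B \<times> carrier G"
        using bij st by (auto simp: bij_betw_def)
      then show "(p (s \<cdot>\<^bsub>S\<^esub> t), q (s \<cdot>\<^bsub>S\<^esub> t)) = (p s, q s) \<cdot>\<^bsub>dir_prod B' G'\<^esub> (p t, q t)"
        by (auto simp: m dir_prod_def p_def q_def B'_def G'_def fi fj case_prod_beta mem_Times_iff)
    qed
  qed
  ultimately show ?thesis using S unfolding rectangular_group_def by blast
qed

end

theory Submission
  imports Defs
begin

text \<open>A congruence \<open>\<rho>\<close> on a completely regular semigroup is Clifford as soon as \<open>ef \<rho> fe\<close> for all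
  idempotents, and its kernel consists of the \<open>a\<close> with \<open>a \<rho> a\<^sup>0\<close>. If \<open>\<nu>\<close> is idempotent pure, then
  \<open>ef \<nu> fe\<close> gives \<open>(ef)\<^sup>2 \<nu> ef\<close>, so that \<open>ef\<close> is idempotent; if \<open>S\<close> is orthodox, then \<open>\<Y>\<close> is an
  idempotent pure Clifford congruence containing \<open>\<nu>\<close>. The conditions on \<open>\<nu>\<close> all say that \<open>\<nu>\<close> is
  idempotent pure. For the conditions on \<open>\<D>\<close> one uses that \<open>\<D> = \<J>\<close> is a semilattice congruence,
  and that \<open>ef = (ge)(fg)\<close> for \<open>g = (ef)\<^sup>0\<close> with idempotents \<open>ge\<close>, \<open>fg\<close> in the \<open>\<D>\<close>-class of \<open>ef\<close>;
  so it suffices to multiply idempotents within a \<open>\<D>\<close>-class.\<close>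

section \<open>Subgroups and the unary operation\<close>

text \<open>\<open>nu\<close>, \<open>tau\<close> and \<open>lower_k\<close> are
  \<open>LEAST\<close> and \<open>GREATEST\<close> terms, about which nothing can be said before
  existence is settled. For \<open>nu\<close> and \<open>lower_k\<close> the quotient condition and
  the kernel are therefore rewritten as conditions on fixed pairs, \<open>(ef, fe)\<close> and
  \<open>(a, \<zeta> a)\<close>, which survive arbitrary intersections. The relation
  \<open>rel_Y S\<close> enters because elements related by \<open>nu S\<close> have no handy
  description: it is an explicit upper bound whose purity passes down to \<open>nu S\<close>. In the
  converse directions one pair is tested, \<open>(a, \<zeta> a)\<close>: it always lies in
  \<open>green_H S\<close>, and \<open>rel_F S\<close> or \<open>rel_Y S\<close> can contain it only
  if \<open>a\<close> is idempotent. For the conditions on \<open>green_D S\<close> the obstacle is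
  to compute inside a class without coordinates. The substitute is stability: if \<open>a\<close>
  and \<open>b\<close> lie in one class, then \<open>\<zeta> (ab)\<close> fixes \<open>a\<close>
  from the left and \<open>b\<close> from the right.\<close>

locale sgr =
  fixes S :: "'a sgrp" (structure)
  assumes sg: "semigrp S"
begin

lemma closed [simp, intro]: "a \<in> carrier S \<Longrightarrow> b \<in> carrier S \<Longrightarrow> a \<cdot> b \<in> carrier S"
  using sg by (simp add: semigrp_def)

lemma assoc [simp]:
  "a \<in> carrier S \<Longrightarrow> b \<in> carrier S \<Longrightarrow> c \<in> carrier S \<Longrightarrow> a \<cdot> b \<cdot> c = a \<cdot> (b \<cdot> c)"
  using sg by (simp add: semigrp_def)

lemma idems_iff: "e \<in> idems S \<longleftrightarrow> e \<in> carrier S \<and> e \<cdot> e = e"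
  by (simp add: idems_def)

text \<open>For an idempotent \<open>e\<close> this is the group of units of the monoid
  \<open>eSe\<close>, that is, the largest subgroup of \<open>S\<close> with identity
  \<open>e\<close>. The witness \<open>y\<close> ranges over all of \<open>S\<close>; the inverse
  inside the group is then \<open>e \<cdot> y\<close>.\<close>

definition units_at :: "'a \<Rightarrow> 'a set" where
  "units_at e = {x \<in> carrier S. e \<cdot> x = x \<and> x \<cdot> e = x \<and> (\<exists>y\<in>carrier S. x \<cdot> y = e \<and> y \<cdot> x = e)}"

lemma subgroup_ofE:
  assumes "subgroup_of S G"
  obtains e where "e \<in> G" "\<And>x. x \<in> G \<Longrightarrow> e \<cdot> x = x \<and> x \<cdot> e = x"
    "\<And>x. x \<in> G \<Longrightarrow> \<exists>y\<in>G. x \<cdot> y = e \<and> y \<cdot> x = e"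
proof -
  have G: "G \<subseteq> carrier S" and "is_group (restr S G)"
    using assms by (auto simp: subgroup_of_def)
  then have "\<exists>e\<in>G. (\<forall>x\<in>G. e \<cdot> x = x \<and> x \<cdot> e = x) \<and> (\<forall>x\<in>G. \<exists>y\<in>G. y \<cdot> x = e)"
    unfolding is_group_iff by simp
  then obtain e where e: "e \<in> G" "\<And>x. x \<in> G \<Longrightarrow> e \<cdot> x = x \<and> x \<cdot> e = x"
    "\<And>x. x \<in> G \<Longrightarrow> \<exists>y\<in>G. y \<cdot> x = e" by blast
  have "\<exists>y\<in>G. x \<cdot> y = e \<and> y \<cdot> x = e" if x: "x \<in> G" for x
  proof -
    obtain y where y: "y \<in> G" "y \<cdot> x = e" using e(3)[OF x] by blast
    \<comment> \<open>\<open>is_group_iff\<close> supplies left inverses only. A left inverse of the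
      left inverse \<open>y\<close> turns out to be \<open>x\<close>, so \<open>y\<close> is
      two-sided.\<close>
    obtain w where w: "w \<in> G" "w \<cdot> y = e" using e(3)[OF y(1)] by blast
    have c: "x \<in> carrier S" "y \<in> carrier S" "w \<in> carrier S" using x y w G by auto
    have "w = w \<cdot> (y \<cdot> x)" using e(2) w(1) y(2) by simp
    also have "\<dots> = w \<cdot> y \<cdot> x" using c by simp
    also have "\<dots> = x" using e(2) x w(2) by simp
    finally show ?thesis using y w by blast
  qed
  then show thesis using that e by blast
qed

lemma subgroup_of_units_at:
  assumes "e \<in> idems S"
  shows "subgroup_of S (units_at e)"
proof -
  have e: "e \<in> carrier S" "e \<cdot> e = e" using assms by (auto simp: idems_iff)
  have cl: "x \<cdot> y \<in> units_at e" if xy: "x \<in> units_at e" "y \<in> units_at e" for x y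
  proof -
    obtain u v where uv: "u \<in> carrier S" "x \<cdot> u = e" "u \<cdot> x = e"
      "v \<in> carrier S" "y \<cdot> v = e" "v \<cdot> y = e"
      using xy by (auto simp: units_at_def)
    have c: "x \<in> carrier S" "e \<cdot> x = x" "x \<cdot> e = x" "y \<in> carrier S" "e \<cdot> y = y" "y \<cdot> e = y"
      using xy by (auto simp: units_at_def)
    have "e \<cdot> (x \<cdot> y) = x \<cdot> y" using assoc[of e x y] c e by simp
    moreover have "x \<cdot> y \<cdot> e = x \<cdot> y" using c e by simp
    moreover have "x \<cdot> y \<cdot> (v \<cdot> u) = e"
    proof -
      have "x \<cdot> y \<cdot> (v \<cdot> u) = x \<cdot> ((y \<cdot> v) \<cdot> u)" using c uv(1,4) by simp
      also have "\<dots> = e" using assoc[of x e u] c uv e by simp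
      finally show ?thesis .
    qed
    moreover have "v \<cdot> u \<cdot> (x \<cdot> y) = e"
    proof -
      have "v \<cdot> u \<cdot> (x \<cdot> y) = v \<cdot> ((u \<cdot> x) \<cdot> y)" using c uv(1,4) by simp
      then show ?thesis using c uv by simp
    qed
    ultimately show ?thesis using c uv by (auto simp: units_at_def)
  qed
  have inv: "\<exists>y\<in>units_at e. y \<cdot> x = e" if x: "x \<in> units_at e" for x
  proof -
    have c: "x \<in> carrier S" "e \<cdot> x = x" "x \<cdot> e = x" using x by (auto simp: units_at_def)
    obtain u where u: "u \<in> carrier S" "x \<cdot> u = e" "u \<cdot> x = e"
      using x by (auto simp: units_at_def)
    \<comment> \<open>The inverse \<open>u\<close> need not satisfy \<open>e \<cdot> u = u\<close>;
      it is replaced by \<open>e \<cdot> u\<close>.\<close>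
    have 1: "e \<cdot> u \<cdot> x = e" using c u e by simp
    have 2: "x \<cdot> (e \<cdot> u) = e"
      using assoc[of x e u] c u e by simp
    have 3: "e \<cdot> u \<cdot> e = e \<cdot> u"
    proof -
      have "e \<cdot> u \<cdot> e = e \<cdot> u \<cdot> (x \<cdot> u)" using u by simp
      also have "\<dots> = e \<cdot> (u \<cdot> x) \<cdot> u" using u(1) c e by simp
      also have "\<dots> = e \<cdot> u" using u e by simp
      finally show ?thesis .
    qed
    have 4: "e \<cdot> (e \<cdot> u) = e \<cdot> u" using assoc[of e e u] e u by simp
    show ?thesis
      using 1 2 3 4 c u e by (intro bexI[of _ "e \<cdot> u"]) (auto simp: units_at_def simp del: assoc)
  qed
  have ee: "e \<in> units_at e" using e by (auto simp: units_at_def)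
  have sub: "units_at e \<subseteq> carrier S" by (auto simp: units_at_def)
  have "semigrp (restr S (units_at e))"
    unfolding semigrp_def using ee cl sub by (auto simp: subset_iff)
  then have "is_group (restr S (units_at e))"
    unfolding is_group_iff using inv ee by (auto intro!: bexI[of _ e] simp: units_at_def)
  then show ?thesis using sub by (simp add: subgroup_of_def)
qed

text \<open>Subgroups sharing an element \<open>a\<close> have the same identity:
  \<open>e \<cdot> d\<close> is \<open>e\<close> because \<open>e\<close> is a left multiple of
  \<open>a\<close>, and \<open>d\<close> because \<open>d\<close> is a right multiple of
  \<open>a\<close>.\<close>

lemma subgroup_of_subset_units_at:
  assumes K: "subgroup_of S K" and a: "a \<in> K" "a \<in> units_at e" and e: "e \<in> idems S"
  shows "K \<subseteq> units_at e"
proof -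
  have Kc: "K \<subseteq> carrier S" using K by (simp add: subgroup_of_def)
  obtain d where d: "d \<in> K" "\<And>x. x \<in> K \<Longrightarrow> d \<cdot> x = x \<and> x \<cdot> d = x"
    "\<And>x. x \<in> K \<Longrightarrow> \<exists>y\<in>K. x \<cdot> y = d \<and> y \<cdot> x = d" by (rule subgroup_ofE[OF K]) blast
  obtain y where y: "y \<in> K" "a \<cdot> y = d" using d(3)[OF a(1)] by blast
  obtain x where x: "x \<in> carrier S" "x \<cdot> a = e" using a(2) by (auto simp: units_at_def)
  have c: "a \<in> carrier S" "y \<in> carrier S" "d \<in> carrier S" "e \<in> carrier S"
    using a y d Kc e by (auto simp: idems_iff)
  have "e \<cdot> d = x \<cdot> (a \<cdot> d)" using x c assoc[of x a d] by simp
  then have "e \<cdot> d = e" using d(2)[OF a(1)] x by simp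
  moreover have "e \<cdot> d = e \<cdot> a \<cdot> y" using c y by simp
  then have "e \<cdot> d = d" using a(2) y by (simp add: units_at_def)
  ultimately have "d = e" by simp
  show ?thesis
  proof
    fix k assume k: "k \<in> K"
    then show "k \<in> units_at e"
      using d(2,3)[OF k] Kc \<open>d = e\<close> unfolding units_at_def by auto
  qed
qed

text \<open>Every subgroup through \<open>a\<close> is contained in \<open>units_at e\<close>, so
  the description in \<open>cr_inv\<close> denotes this group.\<close>

lemma maximal_subgroup_unique:
  assumes e: "e \<in> idems S" and a: "a \<in> units_at e"
  shows "(THE G. maximal_subgroup S G \<and> a \<in> G) = units_at e"
proof (rule the_equality)
  have sub: "K \<subseteq> units_at e" if "subgroup_of S K" "a \<in> K" for K
    using subgroup_of_subset_units_at[OF that a e] .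
  show "maximal_subgroup S (units_at e) \<and> a \<in> units_at e"
    using subgroup_of_units_at[OF e] sub a
    unfolding maximal_subgroup_def by (meson subsetD subset_antisym)
  fix G assume "maximal_subgroup S G \<and> a \<in> G"
  then show "G = units_at e"
    using subgroup_of_units_at[OF e] sub[of G]
    unfolding maximal_subgroup_def by metis
qed

text \<open>An inverse that commutes with \<open>a\<close> is the group inverse: both are units at
  \<open>a \<cdot> x\<close>. This replaces the \<open>THE\<close> in \<open>cr_inv\<close> by
  equations.\<close>

lemma cr_inv_eqI:
  assumes a: "a \<in> carrier S" and x: "x \<in> carrier S"
    and ax: "a \<cdot> x = x \<cdot> a" "a \<cdot> (x \<cdot> a) = a" "x \<cdot> (a \<cdot> x) = x"
  shows "cr_inv S a = x"
proof -
  define e where "e = a \<cdot> x"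
  have ex: "e \<cdot> x = x" "e \<cdot> a = a" "a \<cdot> e = a" "x \<cdot> e = x"
    using a x ax unfolding e_def by (metis assoc)+
  have ee: "e \<cdot> e = e" using a x assoc[of e a x] ex by (simp add: e_def)
  have e: "e \<in> idems S" using a x ee by (simp add: idems_iff e_def)
  have U: "a \<in> units_at e" "x \<in> units_at e"
    using a x ex ax(1) unfolding units_at_def by (auto simp: e_def)
  have "is_group (restr S (units_at e))"
    using subgroup_of_units_at[OF e] by (simp add: subgroup_of_def)
  then interpret G: group "monoid_of (restr S (units_at e))" by (simp add: is_group_def)
  have C: "carrier (monoid_of (restr S (units_at e))) = units_at e"
    and M: "mult (monoid_of (restr S (units_at e))) = sg_mult S"
    by (simp_all add: monoid_of_def)
  have eU: "e \<in> units_at e" using e by (auto simp: units_at_def idems_iff)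
  have "\<one>\<^bsub>monoid_of (restr S (units_at e))\<^esub> = e"
  proof -
    have "e \<cdot> y = y" if "y \<in> units_at e" for y using that by (simp add: units_at_def)
    then show ?thesis using G.one_unique[of e] eU unfolding C M by metis
  qed
  then have "inv\<^bsub>monoid_of (restr S (units_at e))\<^esub> a = x"
    using G.inv_equality[of x a] U ax(1) unfolding C M by (metis e_def)
  then show ?thesis
    unfolding cr_inv_def maximal_subgroup_unique[OF e U(1)] .
qed

text \<open>The equational form serves twice: it provides \<open>cr_inv\<close> on \<open>S\<close>,
  and it passes to quotients, where subgroups would be awkward to exhibit.\<close>

lemma completely_regular_iff:
  "completely_regular S \<longleftrightarrow>
    (\<forall>a\<in>carrier S. \<exists>x\<in>carrier S. a \<cdot> x = x \<cdot> a \<and> a \<cdot> (x \<cdot> a) = a \<and> x \<cdot> (a \<cdot> x) = x)"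
proof
  assume "completely_regular S"
  then have C: "carrier S = \<Union>{G. subgroup_of S G}" by (simp add: completely_regular_def)
  show "\<forall>a\<in>carrier S. \<exists>x\<in>carrier S. a \<cdot> x = x \<cdot> a \<and> a \<cdot> (x \<cdot> a) = a \<and> x \<cdot> (a \<cdot> x) = x"
  proof
    fix a assume "a \<in> carrier S"
    then obtain G where G: "subgroup_of S G" "a \<in> G" using C by blast
    then obtain e where e: "\<And>x. x \<in> G \<Longrightarrow> e \<cdot> x = x \<and> x \<cdot> e = x"
      "\<exists>y\<in>G. a \<cdot> y = e \<and> y \<cdot> a = e" by (meson subgroup_ofE)
    then obtain y where y: "y \<in> G" "a \<cdot> y = e" "y \<cdot> a = e" by blast
    then have "y \<in> carrier S" using G by (auto simp: subgroup_of_def)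
    then show "\<exists>x\<in>carrier S. a \<cdot> x = x \<cdot> a \<and> a \<cdot> (x \<cdot> a) = a \<and> x \<cdot> (a \<cdot> x) = x"
      using e(1)[OF G(2)] e(1)[OF y(1)] y by (intro bexI[of _ y]) auto
  qed
next
  assume R: "\<forall>a\<in>carrier S. \<exists>x\<in>carrier S. a \<cdot> x = x \<cdot> a \<and> a \<cdot> (x \<cdot> a) = a \<and> x \<cdot> (a \<cdot> x) = x"
  have "\<exists>G. subgroup_of S G \<and> a \<in> G" if a: "a \<in> carrier S" for a
  proof -
    obtain x where x: "x \<in> carrier S" "a \<cdot> x = x \<cdot> a" "a \<cdot> (x \<cdot> a) = a" "x \<cdot> (a \<cdot> x) = x"
      using R a by blast
    have 1: "x \<cdot> (a \<cdot> a) = a" using x(1,2,3) a by (metis assoc)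
    have "x \<cdot> a \<in> idems S" using x a by (simp add: idems_iff)
    moreover have "a \<in> units_at (x \<cdot> a)" using x a 1 unfolding units_at_def by auto
    ultimately show ?thesis using subgroup_of_units_at by blast
  qed
  then show "completely_regular S"
    using sg unfolding completely_regular_def by (auto simp: subgroup_of_def)
qed

end

section \<open>Congruences and quotients\<close>

context sgr
begin

lemma congD:
  assumes "sg_congruence S \<rho>"
  shows cong_refl: "a \<in> carrier S \<Longrightarrow> (a, a) \<in> \<rho>"
    and cong_sym: "(a, b) \<in> \<rho> \<Longrightarrow> (b, a) \<in> \<rho>"
    and cong_trans: "(a, b) \<in> \<rho> \<Longrightarrow> (b, c) \<in> \<rho> \<Longrightarrow> (a, c) \<in> \<rho>"
    and cong_carrier: "(a, b) \<in> \<rho> \<Longrightarrow> a \<in> carrier S \<and> b \<in> carrier S"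
    and cong_left: "(a, b) \<in> \<rho> \<Longrightarrow> c \<in> carrier S \<Longrightarrow> (c \<cdot> a, c \<cdot> b) \<in> \<rho>"
    and cong_right: "(a, b) \<in> \<rho> \<Longrightarrow> c \<in> carrier S \<Longrightarrow> (a \<cdot> c, b \<cdot> c) \<in> \<rho>"
proof -
  have E: "refl_on (carrier S) \<rho>" "sym \<rho>" "trans \<rho>" "\<rho> \<subseteq> carrier S \<times> carrier S"
    using assms by (auto simp: sg_congruence_def equiv_def)
  show "a \<in> carrier S \<Longrightarrow> (a, a) \<in> \<rho>" using E(1) by (rule refl_onD)
  show "(a, b) \<in> \<rho> \<Longrightarrow> (b, a) \<in> \<rho>" using E(2) by (rule symD)
  show "(a, b) \<in> \<rho> \<Longrightarrow> (b, c) \<in> \<rho> \<Longrightarrow> (a, c) \<in> \<rho>" using E(3) by (rule transD)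
  show "(a, b) \<in> \<rho> \<Longrightarrow> a \<in> carrier S \<and> b \<in> carrier S" using E(4) by blast
  show "(a, b) \<in> \<rho> \<Longrightarrow> c \<in> carrier S \<Longrightarrow> (c \<cdot> a, c \<cdot> b) \<in> \<rho>"
    "(a, b) \<in> \<rho> \<Longrightarrow> c \<in> carrier S \<Longrightarrow> (a \<cdot> c, b \<cdot> c) \<in> \<rho>"
    using assms by (simp_all add: sg_congruence_def)
qed

lemma cong_mult:
  assumes "sg_congruence S \<rho>" "(a, b) \<in> \<rho>" "(c, d) \<in> \<rho>"
  shows "(a \<cdot> c, b \<cdot> d) \<in> \<rho>"
  using congD[OF assms(1)] assms(2,3) by meson

lemma congI:
  assumes "\<And>a b. (a, b) \<in> \<rho> \<Longrightarrow> a \<in> carrier S \<and> b \<in> carrier S"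
    and "\<And>a. a \<in> carrier S \<Longrightarrow> (a, a) \<in> \<rho>"
    and "\<And>a b. (a, b) \<in> \<rho> \<Longrightarrow> (b, a) \<in> \<rho>"
    and "\<And>a b c. (a, b) \<in> \<rho> \<Longrightarrow> (b, c) \<in> \<rho> \<Longrightarrow> (a, c) \<in> \<rho>"
    and "\<And>a b c. (a, b) \<in> \<rho> \<Longrightarrow> c \<in> carrier S \<Longrightarrow> (c \<cdot> a, c \<cdot> b) \<in> \<rho> \<and> (a \<cdot> c, b \<cdot> c) \<in> \<rho>"
  shows "sg_congruence S \<rho>"
proof -
  have "\<rho> \<subseteq> carrier S \<times> carrier S" using assms(1) by auto
  moreover have "refl_on (carrier S) \<rho>" using assms(2) by (rule refl_onI)
  moreover have "sym \<rho>" using assms(3) by (rule symI)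
  moreover have "trans \<rho>" using assms(4) by (rule transI)
  ultimately show ?thesis using assms(5) by (simp add: sg_congruence_def equiv_def)
qed

text \<open>The family must be nonempty because \<open>\<Inter>{}\<close> is \<open>UNIV\<close>,
  which may exceed the carrier square.\<close>

lemma cong_Inter:
  assumes "\<And>\<rho>. \<rho> \<in> R \<Longrightarrow> sg_congruence S \<rho>" "R \<noteq> {}"
  shows "sg_congruence S (\<Inter>R)"
proof (rule congI)
  note R = congD[OF assms(1)]
  fix a b assume ab: "(a, b) \<in> \<Inter>R"
  then have ab': "(a, b) \<in> \<rho>" if "\<rho> \<in> R" for \<rho> using that by (rule InterD)
  obtain \<rho> where \<rho>: "\<rho> \<in> R" using assms(2) by blast
  show "a \<in> carrier S \<and> b \<in> carrier S" by (rule R(4)[OF \<rho> ab'[OF \<rho>]])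
  show "(b, a) \<in> \<Inter>R" by (rule InterI) (rule R(2)[OF _ ab'])
  fix c
  show "(a, c) \<in> \<Inter>R" if bc: "(b, c) \<in> \<Inter>R"
  proof (rule InterI)
    fix \<rho> assume "\<rho> \<in> R"
    then show "(a, c) \<in> \<rho>" using R(3)[OF _ ab' InterD[OF bc]] by blast
  qed
  show "(c \<cdot> a, c \<cdot> b) \<in> \<Inter>R \<and> (a \<cdot> c, b \<cdot> c) \<in> \<Inter>R" if "c \<in> carrier S"
    using R(5,6)[OF _ ab' that] by blast
qed (use cong_refl[OF assms(1)] in simp)

lemma cong_Int:
  assumes "sg_congruence S \<rho>" "sg_congruence S \<sigma>"
  shows "sg_congruence S (\<rho> \<inter> \<sigma>)"
  using cong_Inter[of "{\<rho>, \<sigma>}"] assms by auto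

lemma quotient_carrier: "carrier (quotient_sg S \<rho>) = carrier S // \<rho>"
  by (simp add: quotient_sg_def)

lemma class_eq_iff:
  assumes "sg_congruence S \<rho>" "a \<in> carrier S" "b \<in> carrier S"
  shows "\<rho> `` {a} = \<rho> `` {b} \<longleftrightarrow> (a, b) \<in> \<rho>"
proof -
  have "equiv (carrier S) \<rho>" using assms(1) by (simp add: sg_congruence_def)
  then show ?thesis using eq_equiv_class_iff assms(2,3) by metis
qed

lemma ball_quotient: "(\<forall>A\<in>carrier S // \<rho>. P A) \<longleftrightarrow> (\<forall>a\<in>carrier S. P (\<rho> `` {a}))"
  by (simp add: quotient_def)

lemma quotient_mult:
  assumes \<rho>: "sg_congruence S \<rho>" and a: "a \<in> carrier S" and b: "b \<in> carrier S"
  shows "\<rho> `` {a} \<cdot>\<^bsub>quotient_sg S \<rho>\<^esub> \<rho> `` {b} = \<rho> `` {a \<cdot> b}"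
proof -
  have *: "\<rho> `` {x \<cdot> y} = \<rho> `` {a \<cdot> b}" if "(a, x) \<in> \<rho>" "(b, y) \<in> \<rho>" for x y
    using class_eq_iff[OF \<rho>, of "x \<cdot> y" "a \<cdot> b"] cong_sym[OF \<rho> cong_mult[OF \<rho> that]]
      cong_carrier[OF \<rho>] that a b by (meson closed)
  \<comment> \<open>Both index sets are nonempty; otherwise the union of constant classes would be
    empty.\<close>
  have "(a, a) \<in> \<rho>" "(b, b) \<in> \<rho>" using cong_refl[OF \<rho>] a b by auto
  then have "(\<Union>x\<in>\<rho> `` {a}. \<Union>y\<in>\<rho> `` {b}. \<rho> `` {a \<cdot> b}) = \<rho> `` {a \<cdot> b}" by blast
  moreover have "(\<Union>x\<in>\<rho> `` {a}. \<Union>y\<in>\<rho> `` {b}. \<rho> `` {x \<cdot> y}) =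
      (\<Union>x\<in>\<rho> `` {a}. \<Union>y\<in>\<rho> `` {b}. \<rho> `` {a \<cdot> b})"
    by (intro SUP_cong refl *) simp_all
  ultimately show ?thesis unfolding quotient_sg_def by simp
qed

lemma semigrp_quotient:
  assumes \<rho>: "sg_congruence S \<rho>"
  shows "semigrp (quotient_sg S \<rho>)"
proof -
  have "carrier S \<noteq> {}" using sg by (simp add: semigrp_def)
  then show ?thesis
    unfolding semigrp_def quotient_carrier
    by (auto simp: quotient_mult[OF \<rho>] quotientI elim!: quotientE)
qed

lemma semilattice_quotient_iff:
  assumes \<rho>: "sg_congruence S \<rho>"
  shows "semilattice_sg (quotient_sg S \<rho>) \<longleftrightarrow>
    (\<forall>a\<in>carrier S. (a \<cdot> a, a) \<in> \<rho>) \<and> (\<forall>a\<in>carrier S. \<forall>b\<in>carrier S. (a \<cdot> b, b \<cdot> a) \<in> \<rho>)"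
proof -
  have "semilattice_sg (quotient_sg S \<rho>) \<longleftrightarrow>
    (\<forall>a\<in>carrier S. \<rho> `` {a \<cdot> a} = \<rho> `` {a}) \<and>
    (\<forall>a\<in>carrier S. \<forall>b\<in>carrier S. \<rho> `` {a \<cdot> b} = \<rho> `` {b \<cdot> a})"
    using semigrp_quotient[OF \<rho>] unfolding semilattice_sg_def quotient_carrier ball_quotient
    by (simp add: quotient_mult[OF \<rho>])
  then show ?thesis by (simp add: class_eq_iff[OF \<rho>])
qed

end

section \<open>Completely regular semigroups\<close>

locale cr_sgr = sgr +
  assumes cr: "completely_regular S"
begin

abbreviation inv_of :: "'a \<Rightarrow> 'a" (\<open>\<iota>\<close>) where "\<iota> \<equiv> cr_inv S"
abbreviation zero_of :: "'a \<Rightarrow> 'a" (\<open>\<zeta>\<close>) where "\<zeta> \<equiv> cr_zero S"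

lemma inv_props:
  assumes "a \<in> carrier S"
  shows inv_closed [simp, intro]: "\<iota> a \<in> carrier S"
    and inv_comm: "\<iota> a \<cdot> a = a \<cdot> \<iota> a"
    and mult_inv_mult: "a \<cdot> (\<iota> a \<cdot> a) = a"
    and inv_mult_inv: "\<iota> a \<cdot> (a \<cdot> \<iota> a) = \<iota> a"
proof -
  obtain x where x: "x \<in> carrier S" "a \<cdot> x = x \<cdot> a" "a \<cdot> (x \<cdot> a) = a" "x \<cdot> (a \<cdot> x) = x"
    using cr assms unfolding completely_regular_iff by blast
  have "\<iota> a = x" using cr_inv_eqI[OF assms x] .
  then show "\<iota> a \<in> carrier S" "\<iota> a \<cdot> a = a \<cdot> \<iota> a" "a \<cdot> (\<iota> a \<cdot> a) = a"
    "\<iota> a \<cdot> (a \<cdot> \<iota> a) = \<iota> a" using x by simp_all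
qed

lemma mult_inv [simp]: "a \<in> carrier S \<Longrightarrow> a \<cdot> \<iota> a = \<zeta> a"
  by (simp add: cr_zero_def)

lemma inv_mult [simp]: "a \<in> carrier S \<Longrightarrow> \<iota> a \<cdot> a = \<zeta> a"
  by (simp add: inv_comm)

lemma zero_closed [simp, intro]: "a \<in> carrier S \<Longrightarrow> \<zeta> a \<in> carrier S"
  using closed[of a "\<iota> a"] by simp

lemma mult_zero [simp]: "a \<in> carrier S \<Longrightarrow> a \<cdot> \<zeta> a = a"
  using mult_inv_mult[of a] by simp

lemma inv_mult_zero [simp]: "a \<in> carrier S \<Longrightarrow> \<iota> a \<cdot> \<zeta> a = \<iota> a"
  using inv_mult_inv[of a] by simp

lemma zero_mult [simp]: "a \<in> carrier S \<Longrightarrow> \<zeta> a \<cdot> a = a"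
  using assoc[of a "\<iota> a" a] by simp

lemma zero_mult_inv [simp]: "a \<in> carrier S \<Longrightarrow> \<zeta> a \<cdot> \<iota> a = \<iota> a"
  using assoc[of "\<iota> a" a "\<iota> a"] by simp

lemma zero_idem: "a \<in> carrier S \<Longrightarrow> \<zeta> a \<in> idems S"
  unfolding idems_iff using assoc[of "\<zeta> a" a "\<iota> a"] by simp

lemma zero_zero_mult [simp]: "a \<in> carrier S \<Longrightarrow> \<zeta> a \<cdot> \<zeta> a = \<zeta> a"
  using zero_idem by (simp add: idems_iff)

text \<open>Since \<open>assoc\<close> brackets products to the right, two-letter rules fail to
  match inside a longer word. These are their versions with a tail \<open>b\<close>.\<close>

lemma cancel [simp]:
  assumes "a \<in> carrier S" "b \<in> carrier S"
  shows "\<zeta> a \<cdot> (a \<cdot> b) = a \<cdot> b" "\<zeta> a \<cdot> (\<iota> a \<cdot> b) = \<iota> a \<cdot> b" "\<zeta> a \<cdot> (\<zeta> a \<cdot> b) = \<zeta> a \<cdot> b"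
    "a \<cdot> (\<zeta> a \<cdot> b) = a \<cdot> b" "\<iota> a \<cdot> (\<zeta> a \<cdot> b) = \<iota> a \<cdot> b"
    "a \<cdot> (\<iota> a \<cdot> b) = \<zeta> a \<cdot> b" "\<iota> a \<cdot> (a \<cdot> b) = \<zeta> a \<cdot> b"
  using assms by (simp_all flip: assoc)

lemma idem_inv: "e \<in> idems S \<Longrightarrow> \<iota> e = e"
  unfolding idems_iff by (rule cr_inv_eqI) auto

lemma idem_zero: "e \<in> idems S \<Longrightarrow> \<zeta> e = e"
  using mult_inv[of e] idem_inv[of e] by (simp add: idems_iff)

lemma idem_closed: "e \<in> idems S \<Longrightarrow> e \<in> carrier S"
  by (simp add: idems_iff)

lemma inv_inv: "a \<in> carrier S \<Longrightarrow> \<iota> (\<iota> a) = a"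
  by (rule cr_inv_eqI) auto

lemma zero_inv: "a \<in> carrier S \<Longrightarrow> \<zeta> (\<iota> a) = \<zeta> a"
  using mult_inv[of "\<iota> a"] by (simp add: inv_inv)

lemma idemI_zero: "a \<in> carrier S \<Longrightarrow> \<zeta> a = a \<Longrightarrow> a \<in> idems S"
  using zero_idem by force

text \<open>A left identity of \<open>y\<close> fixes every right multiple of \<open>y\<close>, in
  particular \<open>y \<cdot> \<iota> y\<close>.\<close>

lemma left_fix_zero:
  assumes "x \<in> carrier S" "y \<in> carrier S" "x \<cdot> y = y"
  shows "x \<cdot> \<zeta> y = \<zeta> y"
  using assoc[of x y "\<iota> y"] assms by simp

lemma right_fix_zero:
  assumes "x \<in> carrier S" "y \<in> carrier S" "y \<cdot> x = y"
  shows "\<zeta> y \<cdot> x = \<zeta> y"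
  using assoc[of "\<iota> y" y x] assms by simp

subsection \<open>Green's relations\<close>

text \<open>The preorder of principal two-sided ideals. As
  \<open>b = \<zeta> b \<cdot> b \<cdot> \<zeta> b\<close>, the set \<open>SbS\<close> is the ideal
  generated by \<open>b\<close>.\<close>

definition jle :: "'a \<Rightarrow> 'a \<Rightarrow> bool" (infix \<open>\<preceq>\<close> 50) where
  "a \<preceq> b \<longleftrightarrow> (\<exists>x\<in>carrier S. \<exists>y\<in>carrier S. a = x \<cdot> (b \<cdot> y))"

lemma jleI: "a = x \<cdot> (b \<cdot> y) \<Longrightarrow> x \<in> carrier S \<Longrightarrow> y \<in> carrier S \<Longrightarrow> a \<preceq> b"
  by (auto simp: jle_def)

lemma jle_refl: "a \<in> carrier S \<Longrightarrow> a \<preceq> a"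
  by (rule jleI[of _ "\<zeta> a" _ "\<zeta> a"]) auto

lemma jle_trans:
  assumes "a \<preceq> b" "b \<preceq> c" "c \<in> carrier S"
  shows "a \<preceq> c"
proof -
  obtain x y u v where "x \<in> carrier S" "y \<in> carrier S" "a = x \<cdot> (b \<cdot> y)"
    "u \<in> carrier S" "v \<in> carrier S" "b = u \<cdot> (c \<cdot> v)"
    using assms(1,2) unfolding jle_def by blast
  then show ?thesis using assms(3) by (intro jleI[of _ "x \<cdot> u" _ "v \<cdot> y"]) auto
qed

lemma jle_mult_left: "a \<in> carrier S \<Longrightarrow> b \<in> carrier S \<Longrightarrow> a \<cdot> b \<preceq> a"
  by (rule jleI[of _ "\<zeta> a" _ b]) auto

lemma jle_mult_right: "a \<in> carrier S \<Longrightarrow> b \<in> carrier S \<Longrightarrow> a \<cdot> b \<preceq> b"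
  by (rule jleI[of _ a _ "\<zeta> b"]) auto

lemma jle_square: "a \<in> carrier S \<Longrightarrow> a \<preceq> a \<cdot> a"
  by (rule jleI[of _ "\<iota> a" _ "\<zeta> a"]) auto

text \<open>The square \<open>(ab)(ab) = a(ba)b\<close> lies in the ideal of \<open>ba\<close>, and
  each element is below its square.\<close>

lemma jle_swap:
  assumes "a \<in> carrier S" "b \<in> carrier S"
  shows "a \<cdot> b \<preceq> b \<cdot> a"
proof -
  have "a \<cdot> b \<cdot> (a \<cdot> b) \<preceq> b \<cdot> a"
    using assms by (intro jleI[of _ a _ b]) auto
  then show ?thesis using jle_trans[OF jle_square[of "a \<cdot> b"]] assms by simp
qed

text \<open>So \<open>ab\<close> is a meet of \<open>a\<close> and \<open>b\<close> in the preorder,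
  whence the equivalence \<open>J\<close> is a congruence. Squaring \<open>d\<close> with the two
  factorizations side by side yields \<open>u b v x a y\<close>; here \<open>b\<close> stands before
  \<open>a\<close>, and \<open>jle_swap\<close> carries it behind.\<close>

lemma jle_glb:
  assumes "d \<preceq> a" "d \<preceq> b" "a \<in> carrier S" "b \<in> carrier S"
  shows "d \<preceq> a \<cdot> b"
proof -
  obtain x y u v where xy: "x \<in> carrier S" "y \<in> carrier S" "d = x \<cdot> (a \<cdot> y)"
    "u \<in> carrier S" "v \<in> carrier S" "d = u \<cdot> (b \<cdot> v)"
    using assms(1,2) unfolding jle_def by blast
  have "d \<cdot> d = u \<cdot> (b \<cdot> v) \<cdot> (x \<cdot> (a \<cdot> y))" using xy(3,6) by simp
  then have "d \<cdot> d \<preceq> b \<cdot> (v \<cdot> (x \<cdot> a))"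
    using xy(1,2,4,5) assms(3,4) by (intro jleI[of _ u _ y]) auto
  moreover have "b \<cdot> (v \<cdot> (x \<cdot> a)) \<preceq> v \<cdot> (x \<cdot> a) \<cdot> b"
    using xy assms by (intro jle_swap) auto
  moreover have "v \<cdot> (x \<cdot> a) \<cdot> b \<preceq> a \<cdot> b"
    using xy assms by (intro jleI[of _ "v \<cdot> x" _ "\<zeta> b"]) auto
  moreover have "d \<in> carrier S" using xy assms by simp
  moreover from this have "d \<preceq> d \<cdot> d" by (rule jle_square)
  ultimately show ?thesis
    using jle_trans[of d "d \<cdot> d" "a \<cdot> b"] jle_trans[of "d \<cdot> d" "b \<cdot> (v \<cdot> (x \<cdot> a))" "a \<cdot> b"]
      jle_trans[of "b \<cdot> (v \<cdot> (x \<cdot> a))" "v \<cdot> (x \<cdot> a) \<cdot> b" "a \<cdot> b"] assms(3,4) by blast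
qed

definition J :: "'a \<Rightarrow> 'a \<Rightarrow> bool" (infix \<open>\<sim>\<close> 50) where
  "a \<sim> b \<longleftrightarrow> a \<in> carrier S \<and> b \<in> carrier S \<and> a \<preceq> b \<and> b \<preceq> a"

lemma J_refl: "a \<in> carrier S \<Longrightarrow> a \<sim> a"
  by (simp add: J_def jle_refl)

lemma J_sym: "a \<sim> b \<Longrightarrow> b \<sim> a"
  by (simp add: J_def)

lemma J_trans: "a \<sim> b \<Longrightarrow> b \<sim> c \<Longrightarrow> a \<sim> c"
  unfolding J_def using jle_trans[of a b c] jle_trans[of c b a] by simp

lemma J_carrier: "a \<sim> b \<Longrightarrow> a \<in> carrier S" "a \<sim> b \<Longrightarrow> b \<in> carrier S"
  by (simp_all add: J_def)

lemma jle_mono: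
  assumes "a \<preceq> b" "c \<preceq> d" "a \<in> carrier S" "b \<in> carrier S" "c \<in> carrier S" "d \<in> carrier S"
  shows "a \<cdot> c \<preceq> b \<cdot> d"
  using assms jle_trans[OF jle_mult_left[of a c], of b] jle_trans[OF jle_mult_right[of a c], of d]
  by (intro jle_glb) auto

lemma J_mult: "a \<sim> b \<Longrightarrow> c \<sim> d \<Longrightarrow> a \<cdot> c \<sim> b \<cdot> d"
  unfolding J_def using jle_mono[of a b c d] jle_mono[of b a d c] by simp

lemma J_square: "a \<in> carrier S \<Longrightarrow> a \<cdot> a \<sim> a"
  by (simp add: J_def jle_square jle_mult_left)

lemma J_swap: "a \<in> carrier S \<Longrightarrow> b \<in> carrier S \<Longrightarrow> a \<cdot> b \<sim> b \<cdot> a"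
  by (simp add: J_def jle_swap)

lemma J_zero: "a \<in> carrier S \<Longrightarrow> \<zeta> a \<sim> a"
  unfolding J_def using jle_mult_left[of a "\<iota> a"] jle_mult_left[of "\<zeta> a" a] by simp

lemma J_inv: "a \<in> carrier S \<Longrightarrow> \<iota> a \<sim> a"
  using J_trans[OF J_sym[OF J_zero[of "\<iota> a"]], of a] J_zero[of a] zero_inv[of a] by simp

lemma J_product: "a \<sim> b \<Longrightarrow> a \<cdot> b \<sim> a"
  using J_trans[OF J_mult[OF J_refl J_sym] J_square] J_carrier by metis

lemma jle_product: "a \<sim> b \<Longrightarrow> a \<preceq> a \<cdot> b" "a \<sim> b \<Longrightarrow> b \<preceq> a \<cdot> b"
  using jle_glb[of a a b] jle_glb[of b a b] jle_refl[of a] jle_refl[of b] by (auto simp: J_def)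

text \<open>Stability: a two-sided multiple becomes a one-sided one. From \<open>a = x a q\<close>
  with \<open>q = b y\<close>, the idempotent \<open>\<zeta> q\<close> is a right identity of
  \<open>a\<close>; written as \<open>q \<cdot> \<iota> q\<close> it begins with \<open>b\<close>.
  \<open>stable_L\<close> is dual.\<close>

lemma stable_R:
  assumes "a \<preceq> a \<cdot> b" "a \<in> carrier S" "b \<in> carrier S"
  shows "\<exists>s\<in>carrier S. a = a \<cdot> b \<cdot> s"
proof -
  obtain x y where xy: "x \<in> carrier S" "y \<in> carrier S" "x \<cdot> (a \<cdot> b \<cdot> y) = a"
    using assms(1) unfolding jle_def by metis
  define q where "q = b \<cdot> y"
  have q: "q \<in> carrier S" using assms(3) xy(2) by (simp add: q_def)
  have a: "x \<cdot> (a \<cdot> q) = a" using xy assms(2,3) by (simp add: q_def)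
  have "x \<cdot> (a \<cdot> q) \<cdot> \<zeta> q = x \<cdot> (a \<cdot> q)" using xy(1) assms(2) q by simp
  then have "a = a \<cdot> \<zeta> q" unfolding a by simp
  also have "\<dots> = a \<cdot> (q \<cdot> \<iota> q)" using q by simp
  also have "\<dots> = a \<cdot> b \<cdot> (y \<cdot> \<iota> q)"
    unfolding q_def using assms(2,3) xy(2) by (simp del: mult_inv)
  finally show ?thesis using xy(2) q by blast
qed

lemma stable_L:
  assumes "b \<preceq> a \<cdot> b" "a \<in> carrier S" "b \<in> carrier S"
  shows "\<exists>s\<in>carrier S. b = s \<cdot> (a \<cdot> b)"
proof -
  obtain x y where xy: "x \<in> carrier S" "y \<in> carrier S" "x \<cdot> (a \<cdot> b \<cdot> y) = b"
    using assms(1) unfolding jle_def by metis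
  define p where "p = x \<cdot> a"
  have p: "p \<in> carrier S" using assms(2) xy(1) by (simp add: p_def)
  have b: "p \<cdot> (b \<cdot> y) = b" using xy assms(2,3) by (simp add: p_def)
  have "\<zeta> p \<cdot> (p \<cdot> (b \<cdot> y)) = p \<cdot> (b \<cdot> y)" using xy(2) assms(3) p by simp
  then have "b = \<zeta> p \<cdot> b" unfolding b by simp
  also have "\<dots> = \<iota> p \<cdot> (p \<cdot> b)" using p assms(3) by simp
  also have "\<dots> = \<iota> p \<cdot> x \<cdot> (a \<cdot> b)"
    unfolding p_def using assms(2,3) xy(1) by (simp del: cancel)
  finally show ?thesis using xy(1) p by blast
qed

text \<open>By stability \<open>a\<close> is a right multiple of \<open>ab\<close>, hence fixed by
  the left identity of \<open>ab\<close>. With the dual lemma this is the main device for computing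
  within a \<open>\<D>\<close>-class.\<close>

lemma zero_product_left:
  assumes "a \<sim> b"
  shows "\<zeta> (a \<cdot> b) \<cdot> a = a"
proof -
  have ab: "a \<in> carrier S" "b \<in> carrier S" using J_carrier[OF assms] by auto
  obtain s where "s \<in> carrier S" "a \<cdot> b \<cdot> s = a"
    using stable_R[OF jle_product(1)[OF assms] ab] by metis
  then show ?thesis using cancel(1)[OF closed[OF ab]] by metis
qed

lemma zero_product_right:
  assumes "a \<sim> b"
  shows "b \<cdot> \<zeta> (a \<cdot> b) = b"
proof -
  have ab: "a \<in> carrier S" "b \<in> carrier S" using J_carrier[OF assms] by auto
  obtain s where s: "s \<in> carrier S" "s \<cdot> (a \<cdot> b) = b"
    using stable_L[OF jle_product(2)[OF assms] ab] by metis
  then have "s \<cdot> (a \<cdot> b) \<cdot> \<zeta> (a \<cdot> b) = s \<cdot> (a \<cdot> b)"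
    using assoc[OF s(1) closed[OF ab] zero_closed[OF closed[OF ab]], unfolded mult_zero[OF closed[OF ab]]]
    by simp
  then show ?thesis unfolding s(2) .
qed

section \<open>Green's relations in terms of divisibility and the unary operations\<close>

lemma green_L_iff:
  "(a, b) \<in> green_L S \<longleftrightarrow> a \<in> carrier S \<and> b \<in> carrier S \<and>
    (\<exists>x\<in>carrier S. a = x \<cdot> b) \<and> (\<exists>y\<in>carrier S. b = y \<cdot> a)"
proof -
  \<comment> \<open>\<open>a = \<zeta> a \<cdot> a\<close> already belongs to \<open>Sa\<close>, so
    the principal left ideal is \<open>Sa\<close> itself.\<close>
  have abs: "insert a ((\<lambda>s. s \<cdot> a) ` carrier S) = (\<lambda>s. s \<cdot> a) ` carrier S" if "a \<in> carrier S" for a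
    using zero_mult[OF that] that by (metis image_eqI insert_absorb zero_closed)
  have sub: "(\<lambda>s. s \<cdot> a) ` carrier S \<subseteq> (\<lambda>s. s \<cdot> b) ` carrier S \<longleftrightarrow> (\<exists>x\<in>carrier S. a = x \<cdot> b)"
    if ab: "a \<in> carrier S" "b \<in> carrier S" for a b
  proof
    assume "(\<lambda>s. s \<cdot> a) ` carrier S \<subseteq> (\<lambda>s. s \<cdot> b) ` carrier S"
    moreover have "a \<in> (\<lambda>s. s \<cdot> a) ` carrier S" using zero_mult ab by (metis image_eqI zero_closed)
    ultimately show "\<exists>x\<in>carrier S. a = x \<cdot> b" by blast
  next
    assume "\<exists>x\<in>carrier S. a = x \<cdot> b"
    then obtain x where "x \<in> carrier S" "a = x \<cdot> b" by blast
    then show "(\<lambda>s. s \<cdot> a) ` carrier S \<subseteq> (\<lambda>s. s \<cdot> b) ` carrier S"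
      using ab by (intro image_subsetI, rename_tac s, rule_tac x = "s \<cdot> x" in image_eqI) simp_all
  qed
  show ?thesis
  proof (cases "a \<in> carrier S \<and> b \<in> carrier S")
    case True
    then have "(a, b) \<in> green_L S \<longleftrightarrow> (\<lambda>s. s \<cdot> a) ` carrier S = (\<lambda>s. s \<cdot> b) ` carrier S"
      by (simp add: green_L_def abs)
    then show ?thesis using True sub[of a b] sub[of b a] unfolding set_eq_subset by simp
  qed (auto simp: green_L_def)
qed

lemma green_R_iff:
  "(a, b) \<in> green_R S \<longleftrightarrow> a \<in> carrier S \<and> b \<in> carrier S \<and>
    (\<exists>x\<in>carrier S. a = b \<cdot> x) \<and> (\<exists>y\<in>carrier S. b = a \<cdot> y)"
proof -
  have abs: "insert a ((\<lambda>s. a \<cdot> s) ` carrier S) = (\<lambda>s. a \<cdot> s) ` carrier S" if "a \<in> carrier S" for a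
    using mult_zero[OF that] that by (metis image_eqI insert_absorb zero_closed)
  have sub: "(\<lambda>s. a \<cdot> s) ` carrier S \<subseteq> (\<lambda>s. b \<cdot> s) ` carrier S \<longleftrightarrow> (\<exists>x\<in>carrier S. a = b \<cdot> x)"
    if ab: "a \<in> carrier S" "b \<in> carrier S" for a b
  proof
    assume "(\<lambda>s. a \<cdot> s) ` carrier S \<subseteq> (\<lambda>s. b \<cdot> s) ` carrier S"
    moreover have "a \<in> (\<lambda>s. a \<cdot> s) ` carrier S" using mult_zero ab by (metis image_eqI zero_closed)
    ultimately show "\<exists>x\<in>carrier S. a = b \<cdot> x" by blast
  next
    assume "\<exists>x\<in>carrier S. a = b \<cdot> x"
    then obtain x where "x \<in> carrier S" "a = b \<cdot> x" by blast
    then show "(\<lambda>s. a \<cdot> s) ` carrier S \<subseteq> (\<lambda>s. b \<cdot> s) ` carrier S"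
      using ab by (intro image_subsetI, rename_tac s, rule_tac x = "x \<cdot> s" in image_eqI) simp_all
  qed
  show ?thesis
  proof (cases "a \<in> carrier S \<and> b \<in> carrier S")
    case True
    then have "(a, b) \<in> green_R S \<longleftrightarrow> (\<lambda>s. a \<cdot> s) ` carrier S = (\<lambda>s. b \<cdot> s) ` carrier S"
      by (simp add: green_R_def abs)
    then show ?thesis using True sub[of a b] sub[of b a] unfolding set_eq_subset by simp
  qed (auto simp: green_R_def)
qed

text \<open>The classes are the maximal subgroups, told apart by their identities. Left to right,
  \<open>\<zeta> b \<cdot> \<zeta> a\<close> is evaluated twice: the \<open>R\<close> part gives
  \<open>\<zeta> a\<close>, the \<open>L\<close> part \<open>\<zeta> b\<close>.\<close>

lemma green_H_iff:
  "(a, b) \<in> green_H S \<longleftrightarrow> a \<in> carrier S \<and> b \<in> carrier S \<and> \<zeta> a = \<zeta> b"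
proof
  assume "(a, b) \<in> green_H S"
  then have LR: "(a, b) \<in> green_L S" "(a, b) \<in> green_R S" by (simp_all add: green_H_def)
  obtain s where s: "a \<in> carrier S" "b \<in> carrier S" "s \<in> carrier S" "a = b \<cdot> s"
    using LR(2) unfolding green_R_iff by blast
  obtain t where t: "t \<in> carrier S" "b = t \<cdot> a" using LR(1) unfolding green_L_iff by blast
  note st = s t
  have "\<zeta> b \<cdot> a = a" using cancel(1)[of b s] st(2,3) unfolding st(4) by simp
  then have "\<zeta> b \<cdot> \<zeta> a = \<zeta> a" using left_fix_zero[OF _ st(1)] st(2) by simp
  moreover have "b \<cdot> \<zeta> a = b" unfolding st(6) using assoc[of t a "\<zeta> a"] st(1,5) by simp
  then have "\<zeta> b \<cdot> \<zeta> a = \<zeta> b" using right_fix_zero[OF _ st(2)] st(1) by simp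
  ultimately show "a \<in> carrier S \<and> b \<in> carrier S \<and> \<zeta> a = \<zeta> b" using st(1,2) by simp
next
  assume A: "a \<in> carrier S \<and> b \<in> carrier S \<and> \<zeta> a = \<zeta> b"
  then have "\<zeta> a \<cdot> b = b" "\<zeta> b \<cdot> a = a" "b \<cdot> \<zeta> a = b" "a \<cdot> \<zeta> b = a"
    using zero_mult mult_zero by metis+
  then have "b = a \<cdot> (\<iota> a \<cdot> b)" "a = b \<cdot> (\<iota> b \<cdot> a)" "b = b \<cdot> \<iota> a \<cdot> a" "a = a \<cdot> \<iota> b \<cdot> b"
    using A by simp_all
  then show "(a, b) \<in> green_H S"
    unfolding green_H_def Int_iff green_L_iff green_R_iff using A
    by (intro conjI bexI[of _ "\<iota> a \<cdot> b"] bexI[of _ "\<iota> b \<cdot> a"] bexI[of _ "b \<cdot> \<iota> a"] bexI[of _ "a \<cdot> \<iota> b"])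
      (metis | simp)+
qed

text \<open>The element linking \<open>a\<close> to \<open>b\<close> is \<open>b \<cdot> a\<close>,
  a left multiple of \<open>a\<close> and a right multiple of \<open>b\<close>; stability provides
  the converse divisibilities.\<close>

lemma green_D_iff: "(a, b) \<in> green_D S \<longleftrightarrow> a \<sim> b"
proof
  assume "(a, b) \<in> green_D S"
  then obtain c where "(a, c) \<in> green_L S" "(c, b) \<in> green_R S"
    unfolding green_D_def by (rule relcompE) simp
  then have "a \<sim> c" "c \<sim> b"
    unfolding J_def green_L_iff green_R_iff using jle_mult_left jle_mult_right by metis+
  then show "a \<sim> b" by (rule J_trans)
next
  assume ab: "a \<sim> b"
  then have c: "a \<in> carrier S" "b \<in> carrier S" and "b \<sim> a" using J_carrier[OF ab] J_sym[OF ab] by auto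
  obtain s where s: "s \<in> carrier S" "b = b \<cdot> a \<cdot> s"
    using stable_R[OF jle_product(1)[OF \<open>b \<sim> a\<close>] c(2,1)] by blast
  obtain t where t: "t \<in> carrier S" "a = t \<cdot> (b \<cdot> a)"
    using stable_L[OF jle_product(2)[OF \<open>b \<sim> a\<close>] c(2,1)] by blast
  have "(a, b \<cdot> a) \<in> green_L S" unfolding green_L_iff using c t by blast
  moreover have "(b \<cdot> a, b) \<in> green_R S" unfolding green_R_iff using c s by blast
  ultimately show "(a, b) \<in> green_D S" by (auto simp: green_D_def)
qed

lemma cong_green_D: "sg_congruence S (green_D S)"
proof (rule congI, unfold green_D_iff)
  fix a b c assume "a \<sim> b" "c \<in> carrier S"
  then show "c \<cdot> a \<sim> c \<cdot> b \<and> a \<cdot> c \<sim> b \<cdot> c" by (simp add: J_mult J_refl)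
qed (fact J_refl J_sym J_trans | simp add: J_def)+

subsection \<open>The congruences \<open>\<nu>\<close>, \<open>\<tau>\<close> and \<open>\<nu>\<^sub>k\<close>\<close>

text \<open>The right-hand side says that the class of \<open>a\<close> is idempotent.
  Multiplication by \<open>a\<close> and by \<open>\<iota> a\<close> leads from one form to the
  other.\<close>

lemma cong_zero:
  assumes \<rho>: "sg_congruence S \<rho>" and a: "a \<in> carrier S"
  shows "(a, \<zeta> a) \<in> \<rho> \<longleftrightarrow> (a \<cdot> a, a) \<in> \<rho>"
proof
  assume "(a, \<zeta> a) \<in> \<rho>"
  from cong_left[OF \<rho> this a] show "(a \<cdot> a, a) \<in> \<rho>" using a by simp
next
  assume "(a \<cdot> a, a) \<in> \<rho>"
  from cong_left[OF \<rho> this inv_closed[OF a]] show "(a, \<zeta> a) \<in> \<rho>" using a by simp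
qed

lemma kernel_iff:
  assumes \<rho>: "sg_congruence S \<rho>"
  shows "a \<in> kernel_rel S \<rho> \<longleftrightarrow> a \<in> carrier S \<and> (a, \<zeta> a) \<in> \<rho>"
proof
  assume "a \<in> kernel_rel S \<rho>"
  then obtain e where e: "a \<in> carrier S" "e \<in> idems S" "(a, e) \<in> \<rho>"
    by (auto simp: kernel_rel_def)
  have "(a \<cdot> a, e \<cdot> e) \<in> \<rho>" using cong_mult[OF \<rho> e(3,3)] .
  then have "(a \<cdot> a, e) \<in> \<rho>" using e(2) by (simp add: idems_iff)
  then have "(a \<cdot> a, a) \<in> \<rho>" using cong_trans[OF \<rho>] cong_sym[OF \<rho> e(3)] by blast
  then show "a \<in> carrier S \<and> (a, \<zeta> a) \<in> \<rho>" using cong_zero[OF \<rho> e(1)] e(1) by simp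
next
  assume "a \<in> carrier S \<and> (a, \<zeta> a) \<in> \<rho>"
  then show "a \<in> kernel_rel S \<rho>" using zero_idem unfolding kernel_rel_def by blast
qed

lemma idempotent_pure_iff:
  "idempotent_pure S \<rho> \<longleftrightarrow> sg_congruence S \<rho> \<and> kernel_rel S \<rho> \<subseteq> idems S"
  unfolding idempotent_pure_def kernel_rel_def by blast

lemma idempotent_pureD:
  assumes "idempotent_pure S \<rho>" "(a, e) \<in> \<rho>" "e \<in> idems S"
  shows "a \<in> idems S"
  using assms cong_carrier[of \<rho> a e] unfolding idempotent_pure_def by blast

lemma idempotent_pureI:
  assumes "sg_congruence S \<rho>" "\<And>a. a \<in> carrier S \<Longrightarrow> (a, \<zeta> a) \<in> \<rho> \<Longrightarrow> a \<in> idems S"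
  shows "idempotent_pure S \<rho>"
  unfolding idempotent_pure_iff using assms kernel_iff[OF assms(1)] by blast

lemma idempotent_pure_mono:
  assumes "idempotent_pure S \<rho>" "sg_congruence S \<sigma>" "\<sigma> \<subseteq> \<rho>"
  shows "idempotent_pure S \<sigma>"
  using assms unfolding idempotent_pure_def by blast

text \<open>Replaces a statement about the quotient by membership of fixed pairs, the form in which
  intersections and purity can be handled.\<close>

lemma clifford_congruence_iff:
  "clifford_congruence S \<rho> \<longleftrightarrow>
    sg_congruence S \<rho> \<and> (\<forall>e\<in>idems S. \<forall>f\<in>idems S. (e \<cdot> f, f \<cdot> e) \<in> \<rho>)"
proof
  assume R: "clifford_congruence S \<rho>"
  then have \<rho>: "sg_congruence S \<rho>" and Q: "clifford (quotient_sg S \<rho>)"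
    by (simp_all add: clifford_congruence_def)
  have "(e \<cdot> f, f \<cdot> e) \<in> \<rho>" if "e \<in> idems S" "f \<in> idems S" for e f
  proof -
    have c: "e \<in> carrier S" "f \<in> carrier S" "e \<cdot> e = e" using that by (auto simp: idems_iff)
    have "\<rho> `` {e} \<in> idems (quotient_sg S \<rho>)"
      using c by (simp add: idems_def quotient_carrier quotient_mult[OF \<rho>] quotientI)
    moreover have "\<rho> `` {f} \<in> carrier (quotient_sg S \<rho>)"
      using c by (simp add: quotient_carrier quotientI)
    ultimately have "\<rho> `` {e} \<cdot>\<^bsub>quotient_sg S \<rho>\<^esub> \<rho> `` {f} = \<rho> `` {f} \<cdot>\<^bsub>quotient_sg S \<rho>\<^esub> \<rho> `` {e}"
      using Q unfolding clifford_def by blast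
    then have "\<rho> `` {e \<cdot> f} = \<rho> `` {f \<cdot> e}" using c by (simp add: quotient_mult[OF \<rho>])
    then show ?thesis using class_eq_iff[OF \<rho>] c by simp
  qed
  then show "sg_congruence S \<rho> \<and> (\<forall>e\<in>idems S. \<forall>f\<in>idems S. (e \<cdot> f, f \<cdot> e) \<in> \<rho>)"
    using \<rho> by simp
next
  assume R: "sg_congruence S \<rho> \<and> (\<forall>e\<in>idems S. \<forall>f\<in>idems S. (e \<cdot> f, f \<cdot> e) \<in> \<rho>)"
  then have \<rho>: "sg_congruence S \<rho>" by simp
  have comm: "(e \<cdot> f, f \<cdot> e) \<in> \<rho>" if "e \<in> idems S" "f \<in> idems S" for e f
    using R that by simp
  \<comment> \<open>Both products are related to \<open>ebe\<close>. For \<open>x = eb\<close> one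
    has \<open>e \<cdot> \<zeta> x = \<zeta> x\<close>, so commuting idempotents give
    \<open>\<zeta> x\<close> related to \<open>\<zeta> x \<cdot> e\<close>, and left multiplication
    by \<open>x\<close> gives \<open>x\<close> related to \<open>x \<cdot> e\<close>; dually for
    \<open>y = be\<close>.\<close>
  have central: "(e \<cdot> b, b \<cdot> e) \<in> \<rho>" if e: "e \<in> idems S" and b: "b \<in> carrier S" for e b
  proof -
    have ee: "e \<in> carrier S" "e \<cdot> e = e" using e by (simp_all add: idems_iff)
    define x where "x = e \<cdot> b"
    define y where "y = b \<cdot> e"
    have c: "x \<in> carrier S" "y \<in> carrier S" using ee b by (simp_all add: x_def y_def)
    have "e \<cdot> x = x" using assoc[of e e b] ee b by (simp add: x_def)
    then have "e \<cdot> \<zeta> x = \<zeta> x" using left_fix_zero ee c by simp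
    then have "(\<zeta> x, \<zeta> x \<cdot> e) \<in> \<rho>" using comm[OF e zero_idem[OF c(1)]] by simp
    from cong_left[OF \<rho> this c(1)] have 1: "(x, x \<cdot> e) \<in> \<rho>" using c ee by simp
    have "y \<cdot> e = y" using ee b by (simp add: y_def)
    then have "\<zeta> y \<cdot> e = \<zeta> y" using right_fix_zero ee c by simp
    then have "(\<zeta> y, e \<cdot> \<zeta> y) \<in> \<rho>" using comm[OF zero_idem[OF c(2)] e] by simp
    from cong_right[OF \<rho> this c(2)] have 2: "(y, e \<cdot> y) \<in> \<rho>" using c ee by simp
    have "x \<cdot> e = e \<cdot> y" using ee b by (simp add: x_def y_def)
    then show ?thesis
      using cong_trans[OF \<rho> 1] cong_sym[OF \<rho> 2] unfolding x_def y_def by simp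
  qed
  interpret Q: sgr "quotient_sg S \<rho>" by unfold_locales (rule semigrp_quotient[OF \<rho>])
  have "completely_regular (quotient_sg S \<rho>)"
    unfolding Q.completely_regular_iff quotient_carrier ball_quotient
  proof
    fix a assume a: "a \<in> carrier S"
    show "\<exists>x\<in>carrier S // \<rho>.
        \<rho> `` {a} \<cdot>\<^bsub>quotient_sg S \<rho>\<^esub> x = x \<cdot>\<^bsub>quotient_sg S \<rho>\<^esub> \<rho> `` {a} \<and>
        \<rho> `` {a} \<cdot>\<^bsub>quotient_sg S \<rho>\<^esub> (x \<cdot>\<^bsub>quotient_sg S \<rho>\<^esub> \<rho> `` {a}) = \<rho> `` {a} \<and>
        x \<cdot>\<^bsub>quotient_sg S \<rho>\<^esub> (\<rho> `` {a} \<cdot>\<^bsub>quotient_sg S \<rho>\<^esub> x) = x"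
      using a by (intro bexI[of _ "\<rho> `` {\<iota> a}"])
        (simp_all add: quotient_mult[OF \<rho>] quotientI)
  qed
  moreover have "A \<cdot>\<^bsub>quotient_sg S \<rho>\<^esub> B = B \<cdot>\<^bsub>quotient_sg S \<rho>\<^esub> A"
    if AB: "A \<in> idems (quotient_sg S \<rho>)" "B \<in> carrier (quotient_sg S \<rho>)" for A B
  proof -
    obtain a where a: "a \<in> carrier S" "A = \<rho> `` {a}"
      using AB(1) by (auto simp: idems_def quotient_carrier elim: quotientE)
    obtain b where b: "b \<in> carrier S" "B = \<rho> `` {b}"
      using AB(2) by (auto simp: quotient_carrier elim: quotientE)
    \<comment> \<open>Idempotents lift: the idempotent class of \<open>a\<close> contains the
      idempotent \<open>\<zeta> a\<close> of \<open>S\<close>, to which \<open>central\<close>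
      applies.\<close>
    have "\<rho> `` {a \<cdot> a} = \<rho> `` {a}"
      using AB(1) a by (simp add: idems_def quotient_mult[OF \<rho>])
    then have "(a, \<zeta> a) \<in> \<rho>" using class_eq_iff[OF \<rho>] cong_zero[OF \<rho>] a by simp
    then have "A = \<rho> `` {\<zeta> a}" using class_eq_iff[OF \<rho>] a by simp
    moreover have "\<rho> `` {\<zeta> a \<cdot> b} = \<rho> `` {b \<cdot> \<zeta> a}"
      using central[OF zero_idem[OF a(1)] b(1)] class_eq_iff[OF \<rho>] a b by simp
    ultimately show ?thesis using a b by (simp add: quotient_mult[OF \<rho>])
  qed
  ultimately show "clifford_congruence S \<rho>"
    using \<rho> unfolding clifford_congruence_def clifford_def by blast
qed

section \<open>Existence of the extremal congruences and the meaning of idempotent purity\<close>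

lemma cong_all: "sg_congruence S (carrier S \<times> carrier S)"
  by (rule congI) auto

lemma cong_eq_rel: "sg_congruence S (eq_rel S)"
  by (rule congI) (auto simp: eq_rel_def)

lemma eq_rel_subset:
  assumes "sg_congruence S \<rho>"
  shows "eq_rel S \<subseteq> \<rho>"
  using cong_refl[OF assms] by (auto simp: eq_rel_def)

lemma kernel_eq_rel: "kernel_rel S (eq_rel S) = idems S"
  by (auto simp: kernel_rel_def eq_rel_def idems_def)

text \<open>The universal relation makes the family nonempty, and by
  \<open>clifford_congruence_iff\<close> its intersection is again a member.\<close>

lemma nu_least:
  shows nu_clifford: "clifford_congruence S (nu S)"
    and nu_subset: "clifford_congruence S \<rho> \<Longrightarrow> nu S \<subseteq> \<rho>"
proof -
  let ?R = "{\<rho>. clifford_congruence S \<rho>}"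
  have "carrier S \<times> carrier S \<in> ?R"
    using cong_all by (auto simp: clifford_congruence_iff idems_iff)
  then have "?R \<noteq> {}" by blast
  then have "sg_congruence S (\<Inter>?R)"
    by (intro cong_Inter) (simp_all add: clifford_congruence_def)
  then have "clifford_congruence S (\<Inter>?R)"
    unfolding clifford_congruence_iff[of "\<Inter>?R"]
    by (rule conjI) (simp add: clifford_congruence_iff)
  then have "nu S = \<Inter>?R"
    unfolding nu_def by (rule Least_equality) (simp add: Inter_lower)
  then show "clifford_congruence S (nu S)" "clifford_congruence S \<rho> \<Longrightarrow> nu S \<subseteq> \<rho>"
    using \<open>clifford_congruence S (\<Inter>?R)\<close> by (auto simp: Inter_lower)
qed

lemma cong_nu: "sg_congruence S (nu S)"
  using nu_clifford by (simp add: clifford_congruence_def)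

text \<open>The greatest element is the join of all idempotent pure congruences, obtained as the
  transitive closure of their union.\<close>

lemma tau_greatest:
  shows tau_pure: "idempotent_pure S (tau S)"
    and subset_tau: "idempotent_pure S \<rho> \<Longrightarrow> \<rho> \<subseteq> tau S"
proof -
  let ?R = "{\<rho>. idempotent_pure S \<rho>}"
  define T where "T = (\<Union>?R)\<^sup>+"
  have R: "sg_congruence S \<rho>" if "\<rho> \<in> ?R" for \<rho> using that by (simp add: idempotent_pure_def)
  \<comment> \<open>A reflexive transitive closure would leave the carrier; the diagonal of the
    carrier comes from \<open>eq_rel S\<close>, a member of the family.\<close>
  have "idempotent_pure S (eq_rel S)"
    using cong_eq_rel kernel_eq_rel by (simp add: idempotent_pure_iff)
  then have refl: "(a, a) \<in> T" if "a \<in> carrier S" for a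
    using that unfolding T_def eq_rel_def by (intro r_into_trancl') auto
  have sub: "\<rho> \<subseteq> T" if "idempotent_pure S \<rho>" for \<rho>
    using that unfolding T_def by (intro subset_trans[OF _ r_into_trancl'[THEN subrelI]]) auto
  have car: "a \<in> carrier S \<and> b \<in> carrier S" if "(a, b) \<in> T" for a b
    using that unfolding T_def by induction (use cong_carrier[OF R] in blast)+
  have "sg_congruence S T"
  proof (rule congI)
    have "sym (\<Union>?R)" using cong_sym[OF R] by (intro symI) blast
    then have "sym T" unfolding T_def by (rule sym_trancl)
    then show "(b, a) \<in> T" if "(a, b) \<in> T" for a b using that by (rule symD)
    show "(c \<cdot> a, c \<cdot> b) \<in> T \<and> (a \<cdot> c, b \<cdot> c) \<in> T" if "(a, b) \<in> T" "c \<in> carrier S" for a b c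
      using that(1) unfolding T_def
    proof induction
      case (base y)
      then show ?case using cong_left[OF R] cong_right[OF R] that(2) by blast
    next
      case (step y z)
      then obtain \<rho> where \<rho>: "\<rho> \<in> ?R" "(y, z) \<in> \<rho>" by blast
      have "(c \<cdot> y, c \<cdot> z) \<in> \<Union>?R" "(y \<cdot> c, z \<cdot> c) \<in> \<Union>?R"
        using cong_left[OF R[OF \<rho>(1)] \<rho>(2) that(2)] cong_right[OF R[OF \<rho>(1)] \<rho>(2) that(2)] \<rho>(1)
        by blast+
      then show ?case using step.IH by (meson trancl_into_trancl)
    qed
    show "(a, c) \<in> T" if "(a, b) \<in> T" "(b, c) \<in> T" for a b c
      using that unfolding T_def by (rule trancl_trans)
  qed (use refl car in auto)
  \<comment> \<open>Along a chain ending in an idempotent, purity is applied link by link from the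
    end backwards.\<close>
  moreover have "b \<in> idems S \<Longrightarrow> a \<in> idems S" if "(a, b) \<in> T" for a b
    using that unfolding T_def
    by (induction rule: converse_trancl_induct) (use idempotent_pureD in blast)+
  ultimately have T: "idempotent_pure S T" unfolding idempotent_pure_def by blast
  then have "tau S = T" unfolding tau_def by (rule Greatest_equality) (rule sub)
  then show "idempotent_pure S (tau S)" "idempotent_pure S \<rho> \<Longrightarrow> \<rho> \<subseteq> tau S"
    using T sub by simp_all
qed

lemma cong_tau: "sg_congruence S (tau S)"
  using tau_pure by (simp add: idempotent_pure_def)

text \<open>By \<open>kernel_iff\<close>, membership of \<open>a\<close> in a kernel concerns the
  single pair \<open>(a, \<zeta> a)\<close>, so congruences with a common kernel may be intersected
  without changing it.\<close>

lemma kernel_lower_k: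
  assumes \<rho>: "sg_congruence S \<rho>"
  shows "kernel_rel S (lower_k S \<rho>) = kernel_rel S \<rho>"
proof -
  let ?R = "{\<sigma>. sg_congruence S \<sigma> \<and> kernel_rel S \<sigma> = kernel_rel S \<rho>}"
  have "?R \<noteq> {}" using \<rho> by blast
  then have c: "sg_congruence S (\<Inter>?R)" by (intro cong_Inter) simp_all
  have "a \<in> kernel_rel S (\<Inter>?R) \<longleftrightarrow> a \<in> kernel_rel S \<rho>" for a
  proof
    assume "a \<in> kernel_rel S (\<Inter>?R)"
    then show "a \<in> kernel_rel S \<rho>" using \<rho> unfolding kernel_iff[OF c] kernel_iff[OF \<rho>] by blast
  next
    assume a: "a \<in> kernel_rel S \<rho>"
    then have "(a, \<zeta> a) \<in> \<sigma>" if "\<sigma> \<in> ?R" for \<sigma>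
      using that kernel_iff[of \<sigma> a] by simp
    then show "a \<in> kernel_rel S (\<Inter>?R)"
      using a kernel_iff[OF \<rho>] unfolding kernel_iff[OF c] by blast
  qed
  then have k: "kernel_rel S (\<Inter>?R) = kernel_rel S \<rho>" by blast
  have "lower_k S \<rho> = \<Inter>?R"
    unfolding lower_k_def by (rule Least_equality) (use c k in \<open>auto simp: Inter_lower\<close>)
  then show ?thesis using k by simp
qed

text \<open>Equality has kernel \<open>idems S\<close>, so both sides say that the kernel of
  \<open>\<rho>\<close> is \<open>idems S\<close>.\<close>

lemma lower_k_eq_rel_iff:
  assumes \<rho>: "sg_congruence S \<rho>"
  shows "lower_k S \<rho> = eq_rel S \<longleftrightarrow> idempotent_pure S \<rho>"
proof
  assume "lower_k S \<rho> = eq_rel S"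
  then have "kernel_rel S \<rho> = idems S" using kernel_lower_k[OF \<rho>] kernel_eq_rel by simp
  then show "idempotent_pure S \<rho>" using \<rho> by (simp add: idempotent_pure_iff)
next
  assume "idempotent_pure S \<rho>"
  then have "kernel_rel S \<rho> \<subseteq> idems S" by (simp add: idempotent_pure_iff)
  moreover have "idems S \<subseteq> kernel_rel S \<rho>"
    using cong_refl[OF \<rho>] idem_closed unfolding kernel_rel_def by blast
  ultimately have "kernel_rel S (eq_rel S) = kernel_rel S \<rho>" using kernel_eq_rel by simp
  then show "lower_k S \<rho> = eq_rel S"
    unfolding lower_k_def using cong_eq_rel eq_rel_subset by (intro Least_equality) simp_all
qed

lemma idempotent_pure_subset_F:
  assumes \<rho>: "idempotent_pure S \<rho>"
  shows "\<rho> \<subseteq> rel_F S"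
proof (rule subrelI)
  fix a b assume ab: "(a, b) \<in> \<rho>"
  have c: "sg_congruence S \<rho>" using \<rho> by (simp add: idempotent_pure_def)
  have "a \<in> carrier S" "b \<in> carrier S" using cong_carrier[OF c ab] by auto
  moreover from this have "(a \<cdot> \<iota> b, \<zeta> b) \<in> \<rho>" using cong_right[OF c ab, of "\<iota> b"] by simp
  ultimately show "(a, b) \<in> rel_F S"
    using idempotent_pureD[OF \<rho> _ zero_idem] by (simp add: rel_F_def)
qed

subsection \<open>Orthodox semigroups\<close>

lemma orthodox_iff: "orthodox S \<longleftrightarrow> (\<forall>e\<in>idems S. \<forall>f\<in>idems S. e \<cdot> f \<in> idems S)"
proof -
  have "regular_sg S"
    unfolding regular_sg_def using sg mult_inv_mult by (metis assoc inv_closed)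
  moreover have "idems S \<noteq> {}" using sg zero_idem unfolding semigrp_def by blast
  moreover have "idems S \<subseteq> carrier S" by (auto simp: idems_iff)
  ultimately show ?thesis
    unfolding orthodox_def subsemigrp_def semigrp_def by (auto simp: subset_iff)
qed

lemma inverses_iff:
  "a \<in> carrier S \<Longrightarrow> x \<in> inverses S a \<longleftrightarrow> x \<in> carrier S \<and> a \<cdot> (x \<cdot> a) = a \<and> x \<cdot> (a \<cdot> x) = x"
  unfolding inverses_def by auto

lemma inv_in_inverses: "a \<in> carrier S \<Longrightarrow> \<iota> a \<in> inverses S a"
  by (simp add: inverses_iff)

text \<open>This reduces orthodoxy to the classes of a semilattice congruence: the
  product of any two idempotents is a product of two idempotents of a single class.\<close>

lemma product_decomposition:
  assumes "e \<in> idems S" "f \<in> idems S"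
  defines "g \<equiv> \<zeta> (e \<cdot> f)"
  shows "g \<cdot> e \<in> idems S" "f \<cdot> g \<in> idems S" "g \<cdot> e \<cdot> (f \<cdot> g) = e \<cdot> f"
proof -
  have c: "e \<in> carrier S" "f \<in> carrier S" "e \<cdot> e = e" "f \<cdot> f = f"
    using assms(1,2) by (simp_all add: idems_iff)
  have ef: "e \<cdot> f \<in> carrier S" using c by simp
  have g: "g \<in> carrier S" "g \<cdot> g = g" using ef by (simp_all add: g_def)
  have "e \<cdot> (e \<cdot> f) = e \<cdot> f" using assoc[of e e f] c by simp
  then have eg: "e \<cdot> g = g" unfolding g_def by (rule left_fix_zero[OF c(1) ef])
  have "e \<cdot> f \<cdot> f = e \<cdot> f" using c by simp
  then have gf: "g \<cdot> f = g" unfolding g_def by (rule right_fix_zero[OF c(2) ef])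
  have "g \<cdot> e \<cdot> (g \<cdot> e) = g \<cdot> (e \<cdot> g) \<cdot> e" using g(1) c(1) by simp
  then show "g \<cdot> e \<in> idems S" using g c(1) by (simp add: eg idems_iff)
  have "f \<cdot> g \<cdot> (f \<cdot> g) = f \<cdot> ((g \<cdot> f) \<cdot> g)" using g(1) c(2) by simp
  then show "f \<cdot> g \<in> idems S" using g c(2) by (simp add: gf idems_iff)
  have "g \<cdot> e \<cdot> (f \<cdot> g) = g \<cdot> (e \<cdot> f \<cdot> g)" using g(1) c(1,2) by simp
  also have "\<dots> = g \<cdot> (e \<cdot> f)" using ef unfolding g_def by (simp only: mult_zero)
  also have "\<dots> = e \<cdot> f" using ef unfolding g_def by (simp only: zero_mult)
  finally show "g \<cdot> e \<cdot> (f \<cdot> g) = e \<cdot> f" .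
qed

text \<open>An arbitrary semilattice congruence is allowed because two are used:
  \<open>green_D S\<close>, and the one that comes with a decomposition into rectangular
  groups.\<close>

lemma orthodoxI:
  assumes \<rho>: "sg_congruence S \<rho>"
    and square: "\<And>a. a \<in> carrier S \<Longrightarrow> (a \<cdot> a, a) \<in> \<rho>"
    and swap: "\<And>a b. a \<in> carrier S \<Longrightarrow> b \<in> carrier S \<Longrightarrow> (a \<cdot> b, b \<cdot> a) \<in> \<rho>"
    and closed: "\<And>a e f. a \<in> carrier S \<Longrightarrow> e \<in> idems S \<Longrightarrow> f \<in> idems S \<Longrightarrow>
      (a, e) \<in> \<rho> \<Longrightarrow> (a, f) \<in> \<rho> \<Longrightarrow> e \<cdot> f \<in> idems S"
  shows "orthodox S"
  unfolding orthodox_iff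
proof (intro ballI)
  fix e f assume e: "e \<in> idems S" and f: "f \<in> idems S"
  have c: "e \<in> carrier S" "f \<in> carrier S" "e \<cdot> e = e" "f \<cdot> f = f"
    using e f by (simp_all add: idems_iff)
  define g where "g = \<zeta> (e \<cdot> f)"
  have ef: "e \<cdot> f \<in> carrier S" using c by simp
  \<comment> \<open>In the semilattice quotient \<open>g\<close>, \<open>ge\<close> and
    \<open>fg\<close> all have the image of \<open>ef\<close>.\<close>
  have gef: "(g, e \<cdot> f) \<in> \<rho>"
    unfolding g_def using cong_sym[OF \<rho>] cong_zero[OF \<rho> ef] square[OF ef] by blast
  have "(g \<cdot> e, e \<cdot> f \<cdot> e) \<in> \<rho>" using cong_right[OF \<rho> gef c(1)] .
  moreover have "(e \<cdot> (f \<cdot> e), e \<cdot> (e \<cdot> f)) \<in> \<rho>"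
    using cong_left[OF \<rho> swap[OF c(2,1)] c(1)] .
  then have "(e \<cdot> f \<cdot> e, e \<cdot> f) \<in> \<rho>" using assoc[of e e f] c by simp
  ultimately have 1: "(g \<cdot> e, e \<cdot> f) \<in> \<rho>" by (rule cong_trans[OF \<rho>])
  have "(f \<cdot> g, f \<cdot> (e \<cdot> f)) \<in> \<rho>" using cong_left[OF \<rho> gef c(2)] .
  moreover have "(f \<cdot> e \<cdot> f, e \<cdot> f \<cdot> f) \<in> \<rho>"
    using cong_right[OF \<rho> swap[OF c(2,1)] c(2)] .
  then have "(f \<cdot> (e \<cdot> f), e \<cdot> f) \<in> \<rho>" using c by simp
  ultimately have 2: "(f \<cdot> g, e \<cdot> f) \<in> \<rho>" by (rule cong_trans[OF \<rho>])
  show "e \<cdot> f \<in> idems S"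
    using closed[OF ef _ _ cong_sym[OF \<rho> 1] cong_sym[OF \<rho> 2]] product_decomposition[OF e f]
    unfolding g_def by simp
qed

lemma orthodoxI_D:
  assumes "\<And>e f. e \<in> idems S \<Longrightarrow> f \<in> idems S \<Longrightarrow> e \<sim> f \<Longrightarrow> e \<cdot> f \<in> idems S"
  shows "orthodox S"
proof (rule orthodoxI[OF cong_green_D], unfold green_D_iff)
  fix a e f assume "e \<in> idems S" "f \<in> idems S" "a \<sim> e" "a \<sim> f"
  then show "e \<cdot> f \<in> idems S" using assms J_trans[OF J_sym] by blast
qed (simp_all add: J_square J_swap)

lemma clifford_idempotent_pure_orthodox:
  assumes \<rho>: "clifford_congruence S \<rho>" and square: "\<And>a. (a, \<zeta> a) \<in> \<rho> \<Longrightarrow> a \<in> idems S"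
  shows "orthodox S"
  unfolding orthodox_iff
proof (intro ballI)
  fix e f assume ef: "e \<in> idems S" "f \<in> idems S"
  then have c: "e \<in> carrier S" "f \<in> carrier S" "e \<cdot> e = e" "f \<cdot> f = f"
    by (simp_all add: idems_iff)
  have \<sigma>: "sg_congruence S \<rho>" "(f \<cdot> e, e \<cdot> f) \<in> \<rho>"
    using \<rho> ef by (simp_all add: clifford_congruence_iff)
  have "(e \<cdot> (f \<cdot> e) \<cdot> f, e \<cdot> (e \<cdot> f) \<cdot> f) \<in> \<rho>"
    using cong_right[OF \<sigma>(1) cong_left[OF \<sigma> c(1)] c(2)] .
  then have "(e \<cdot> f \<cdot> (e \<cdot> f), e \<cdot> f) \<in> \<rho>" using assoc[of e e f] c by simp
  then show "e \<cdot> f \<in> idems S" using square cong_zero[OF \<sigma>(1), of "e \<cdot> f"] c by simp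
qed

text \<open>The passage from \<open>rel_F\<close> to inverses: an idempotent
  \<open>a \<cdot> \<iota> b\<close> is its own \<open>\<zeta>\<close>, so it fixes \<open>a\<close>
  from the left and \<open>\<iota> b\<close> from the right.\<close>

lemma inv_mult_idem:
  assumes "a \<sim> b" "a \<cdot> \<iota> b \<in> idems S"
  shows "\<iota> b \<in> inverses S a"
proof -
  have c: "a \<in> carrier S" "b \<in> carrier S" using J_carrier[OF assms(1)] by auto
  have J: "a \<sim> \<iota> b" using J_trans[OF assms(1) J_sym[OF J_inv[OF c(2)]]] .
  have "a \<cdot> \<iota> b \<cdot> a = a"
    using zero_product_left[OF J] idem_zero[OF assms(2)] by simp
  moreover have "\<iota> b \<cdot> (a \<cdot> \<iota> b) = \<iota> b"
    using zero_product_right[OF J] idem_zero[OF assms(2)] by simp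
  ultimately show ?thesis using c by (simp add: inverses_iff)
qed

lemma F_idem_iff: "e \<in> idems S \<Longrightarrow> f \<in> idems S \<Longrightarrow> (e, f) \<in> rel_F S \<longleftrightarrow> e \<cdot> f \<in> idems S"
  by (simp add: rel_F_def idem_inv idem_closed)

text \<open>For \<open>g = \<zeta> (ef)\<close> the products \<open>eg\<close> and \<open>gf\<close>
  both equal \<open>g\<close>, hence are idempotent. So \<open>g\<close> links \<open>e\<close> to
  \<open>f\<close>, and transitivity gives the claim.\<close>

lemma D_F_congruence_orthodox:
  assumes "sg_congruence S (green_D S \<inter> rel_F S)"
  shows "orthodox S"
proof (rule orthodoxI_D)
  fix e f assume e: "e \<in> idems S" and f: "f \<in> idems S" and J: "e \<sim> f"
  have c: "e \<in> carrier S" "f \<in> carrier S" "e \<cdot> e = e" "f \<cdot> f = f"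
    using e f by (simp_all add: idems_iff)
  define g where "g = \<zeta> (e \<cdot> f)"
  have g: "g \<in> idems S" using c by (simp add: g_def zero_idem)
  have "e \<cdot> (e \<cdot> f) = e \<cdot> f" using assoc[of e e f] c by simp
  then have eg: "e \<cdot> g = g" unfolding g_def using left_fix_zero c by simp
  have "e \<cdot> f \<cdot> f = e \<cdot> f" using c by simp
  then have gf: "g \<cdot> f = g" unfolding g_def using right_fix_zero c by simp
  have "g \<sim> e" unfolding g_def using J_trans[OF J_zero J_product[OF J]] c by simp
  then have "(e, g) \<in> green_D S \<inter> rel_F S" "(g, f) \<in> green_D S \<inter> rel_F S"
    using e f g J_sym[OF \<open>g \<sim> e\<close>] J_trans[OF \<open>g \<sim> e\<close> J]
    by (simp_all add: green_D_iff F_idem_iff eg gf)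
  then have "(e, f) \<in> green_D S \<inter> rel_F S" by (rule cong_trans[OF assms])
  then show "e \<cdot> f \<in> idems S" using F_idem_iff[OF e f] by simp
qed

text \<open>Idempotents are always related by \<open>rel_Theta S\<close>, both sides of its equation
  being \<open>ef\<close>. Multiplying the pair by \<open>e\<close> on the left yields
  \<open>ef = \<zeta> (ef)\<close>.\<close>

lemma D_Theta_congruence_orthodox:
  assumes "sg_congruence S (green_D S \<inter> rel_Theta S)"
  shows "orthodox S"
proof (rule orthodoxI_D)
  fix e f assume e: "e \<in> idems S" and f: "f \<in> idems S" and J: "e \<sim> f"
  have c: "e \<in> carrier S" "f \<in> carrier S" "e \<cdot> e = e"
    using e f by (simp_all add: idems_iff)
  have "(e, f) \<in> green_D S \<inter> rel_Theta S"
    using J c idem_zero[OF e] idem_zero[OF f] by (simp add: green_D_iff rel_Theta_def)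
  from cong_left[OF assms this c(1)] have "(e, e \<cdot> f) \<in> rel_Theta S" using c by simp
  then have "e \<cdot> (e \<cdot> f) = e \<cdot> \<zeta> (e \<cdot> f)" using idem_zero[OF e] by (simp add: rel_Theta_def)
  moreover have ef: "e \<cdot> (e \<cdot> f) = e \<cdot> f" using assoc[of e e f] c by simp
  moreover have "e \<cdot> \<zeta> (e \<cdot> f) = \<zeta> (e \<cdot> f)" using left_fix_zero[OF _ _ ef] c by simp
  ultimately show "e \<cdot> f \<in> idems S" using idemI_zero[of "e \<cdot> f"] c by simp
qed

text \<open>\<open>\<zeta> a\<close> is an inverse of itself, hence of \<open>a\<close>, which
  forces \<open>\<zeta> a = a\<close>. The relation \<open>\<rho>\<close> is left open so that both
  \<open>nu S\<close> and \<open>rel_Y S\<close> can be inserted.\<close>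

lemma subset_Y_idem:
  assumes "\<rho> \<subseteq> rel_Y S" "(a, \<zeta> a) \<in> \<rho>"
  shows "a \<in> idems S"
proof -
  have a: "a \<in> carrier S" "inverses S a = inverses S (\<zeta> a)"
    using assms by (auto simp: rel_Y_def)
  have "\<zeta> a \<in> inverses S (\<zeta> a)" using a(1) by (simp add: inverses_iff)
  then have "\<zeta> a \<cdot> (a \<cdot> \<zeta> a) = \<zeta> a" using a inverses_iff by blast
  then show ?thesis using a(1) idemI_zero by simp
qed

end

section \<open>Consequences of orthodoxy\<close>

locale orthogroup = cr_sgr +
  assumes orth: "orthodox S"
begin

lemma idem_mult: "e \<in> idems S \<Longrightarrow> f \<in> idems S \<Longrightarrow> e \<cdot> f \<in> idems S"
  using orth orthodox_iff by blast

lemma idem_alternating: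
  assumes "e \<in> idems S" "f \<in> idems S"
  shows "e \<cdot> (f \<cdot> (e \<cdot> f)) = e \<cdot> f"
proof -
  have "e \<cdot> f \<cdot> (e \<cdot> f) = e \<cdot> f" using idem_mult[OF assms] by (simp add: idems_iff)
  then show ?thesis using assms by (simp add: idems_iff)
qed

text \<open>With idempotents \<open>p = xa\<close> and \<open>q = by\<close>, the product
  \<open>(ab)(yx)(ab)\<close> is \<open>a q p b\<close>. Since \<open>a = a p\<close> and
  \<open>b = q b\<close>, it is \<open>a (pq)(pq) b\<close>, where orthodoxy removes one factor
  \<open>pq\<close>.\<close>

lemma inverses_mult:
  assumes c: "a \<in> carrier S" "b \<in> carrier S" and x: "x \<in> inverses S a" and y: "y \<in> inverses S b"
  shows "y \<cdot> x \<in> inverses S (a \<cdot> b)"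
proof -
  have x': "x \<in> carrier S" "a \<cdot> (x \<cdot> a) = a" "x \<cdot> (a \<cdot> x) = x"
    and y': "y \<in> carrier S" "b \<cdot> (y \<cdot> b) = b" "y \<cdot> (b \<cdot> y) = y"
    using x y c by (simp_all add: inverses_iff)
  define p where "p = x \<cdot> a"
  define q where "q = b \<cdot> y"
  have pq: "p \<in> carrier S" "q \<in> carrier S" using c x' y' by (simp_all add: p_def q_def)
  have ap: "a \<cdot> p = a" "p \<cdot> x = x" "q \<cdot> b = b" "y \<cdot> q = y"
    using c x' y' by (simp_all add: p_def q_def)
  have "p \<in> idems S" "q \<in> idems S"
    using pq ap c x' y' by (simp_all add: idems_iff p_def q_def)
  then have alt: "p \<cdot> (q \<cdot> (p \<cdot> q)) = p \<cdot> q" "q \<cdot> (p \<cdot> (q \<cdot> p)) = q \<cdot> p"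
    by (simp_all add: idem_alternating)
  have "a \<cdot> b \<cdot> (y \<cdot> x \<cdot> (a \<cdot> b)) = a \<cdot> (q \<cdot> (p \<cdot> b))"
    using c x' y' by (simp add: p_def q_def)
  also have "\<dots> = a \<cdot> p \<cdot> (q \<cdot> (p \<cdot> (q \<cdot> b)))" by (simp only: ap)
  also have "\<dots> = a \<cdot> (p \<cdot> (q \<cdot> (p \<cdot> q))) \<cdot> b" using c pq by simp
  also have "\<dots> = a \<cdot> p \<cdot> (q \<cdot> b)" unfolding alt using c pq by simp
  finally have 1: "a \<cdot> b \<cdot> (y \<cdot> x \<cdot> (a \<cdot> b)) = a \<cdot> b" by (simp only: ap)
  have "y \<cdot> x \<cdot> (a \<cdot> b \<cdot> (y \<cdot> x)) = y \<cdot> (p \<cdot> (q \<cdot> x))"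
    using c x' y' by (simp add: p_def q_def)
  also have "\<dots> = y \<cdot> q \<cdot> (p \<cdot> (q \<cdot> (p \<cdot> x)))" by (simp only: ap)
  also have "\<dots> = y \<cdot> (q \<cdot> (p \<cdot> (q \<cdot> p))) \<cdot> x" using x' y' pq by simp
  also have "\<dots> = y \<cdot> q \<cdot> (p \<cdot> x)" unfolding alt using x' y' pq by simp
  finally have 2: "y \<cdot> x \<cdot> (a \<cdot> b \<cdot> (y \<cdot> x)) = y \<cdot> x" by (simp only: ap)
  show ?thesis using 1 2 c x' y' by (simp add: inverses_iff del: assoc)
qed

text \<open>One common inverse \<open>x\<close> produces two chains of idempotents,
  \<open>ya L xa R xb\<close> and \<open>ay R ax L bx\<close>. They allow any other inverse
  \<open>y\<close> of \<open>a\<close> to be moved over to \<open>b\<close>.\<close>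

lemma inverses_common_subset:
  assumes c: "a \<in> carrier S" "b \<in> carrier S" and x: "x \<in> inverses S a" "x \<in> inverses S b"
  shows "inverses S a \<subseteq> inverses S b"
proof
  fix y assume y: "y \<in> inverses S a"
  have a: "a \<cdot> (x \<cdot> a) = a" "x \<cdot> (a \<cdot> x) = x" "a \<cdot> (y \<cdot> a) = a" "y \<cdot> (a \<cdot> y) = y"
    and b: "b \<cdot> (x \<cdot> b) = b" "x \<cdot> (b \<cdot> x) = x" and xy: "x \<in> carrier S" "y \<in> carrier S"
    using x y c by (simp_all add: inverses_iff)
  have sandwich: "g \<cdot> (k \<cdot> g) = g"
    \<comment> \<open>The equations say \<open>g L h R k\<close>. Writing the last \<open>g\<close>
      as \<open>g h\<close> and then \<open>h\<close> as \<open>k h\<close> creates the word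
      \<open>gkgk\<close>, which orthodoxy shortens.\<close>
    if "g \<in> idems S" "h \<in> idems S" "k \<in> idems S" "g \<cdot> h = g" "h \<cdot> g = h" "h \<cdot> k = k" "k \<cdot> h = h"
    for g h k
  proof -
    have d: "g \<in> carrier S" "h \<in> carrier S" "k \<in> carrier S" using that by (simp_all add: idems_iff)
    have "g \<cdot> (k \<cdot> g) = g \<cdot> (k \<cdot> (g \<cdot> h))" by (simp only: that)
    also have "\<dots> = g \<cdot> (k \<cdot> (g \<cdot> (k \<cdot> h)))" by (simp only: that)
    also have "\<dots> = g \<cdot> (k \<cdot> (g \<cdot> k)) \<cdot> h" using d by simp
    also have "\<dots> = g \<cdot> (k \<cdot> h)" unfolding idem_alternating[OF that(1,3)] using d by simp
    also have "\<dots> = g" by (simp only: that)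
    finally show ?thesis .
  qed
  have sandwich': "g \<cdot> (k \<cdot> g) = g"
    if "g \<in> idems S" "h \<in> idems S" "k \<in> idems S" "h \<cdot> g = g" "g \<cdot> h = h" "k \<cdot> h = k" "h \<cdot> k = h"
    for g h k
  proof -
    have d: "g \<in> carrier S" "h \<in> carrier S" "k \<in> carrier S" using that by (simp_all add: idems_iff)
    have "g \<cdot> (k \<cdot> g) = h \<cdot> g \<cdot> (k \<cdot> g)" by (simp only: that)
    also have "\<dots> = h \<cdot> k \<cdot> g \<cdot> (k \<cdot> g)" by (simp only: that)
    also have "\<dots> = h \<cdot> (k \<cdot> (g \<cdot> (k \<cdot> g)))" using d by simp
    also have "\<dots> = h \<cdot> k \<cdot> g" unfolding idem_alternating[OF that(3,1)] using d by simp
    also have "\<dots> = g" by (simp only: that)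
    finally show ?thesis .
  qed
  define g where "g = y \<cdot> a"
  define h where "h = x \<cdot> a"
  define k where "k = x \<cdot> b"
  define g' where "g' = a \<cdot> y"
  define h' where "h' = a \<cdot> x"
  define k' where "k' = b \<cdot> x"
  note defs = g_def h_def k_def g'_def h'_def k'_def
  have d: "g \<in> carrier S" "h \<in> carrier S" "k \<in> carrier S" "g' \<in> carrier S" "h' \<in> carrier S" "k' \<in> carrier S"
    using c xy by (simp_all add: defs)
  have red: "x \<cdot> (a \<cdot> (x \<cdot> z)) = x \<cdot> z" "x \<cdot> (b \<cdot> (x \<cdot> z)) = x \<cdot> z" "y \<cdot> (a \<cdot> (y \<cdot> z)) = y \<cdot> z"
    "a \<cdot> (x \<cdot> (a \<cdot> z)) = a \<cdot> z" "a \<cdot> (y \<cdot> (a \<cdot> z)) = a \<cdot> z"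
    if "z \<in> carrier S" for z
    using a b c xy that assoc[of x "a \<cdot> x" z] assoc[of x "b \<cdot> x" z] assoc[of y "a \<cdot> y" z]
      assoc[of a "x \<cdot> a" z] assoc[of a "y \<cdot> a" z] by simp_all
  have "g \<in> idems S" "h \<in> idems S" "k \<in> idems S" "g' \<in> idems S" "h' \<in> idems S" "k' \<in> idems S"
    using c xy by (simp_all add: idems_iff defs a b)
  moreover have "g \<cdot> h = g" "h \<cdot> g = h" "h \<cdot> k = k" "k \<cdot> h = h"
    "h' \<cdot> g' = g'" "g' \<cdot> h' = h'" "k' \<cdot> h' = k'" "h' \<cdot> k' = h'"
    using c xy by (simp_all add: defs a b red)
  ultimately have gkg: "g \<cdot> (k \<cdot> g) = g" "g' \<cdot> (k' \<cdot> g') = g'"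
    using sandwich[of g h k] sandwich'[of g' h' k'] by simp_all
  \<comment> \<open>As \<open>x = x a x\<close>, the element \<open>b = b x b\<close> factors as
    \<open>(bx) a (xb)\<close>. After this substitution \<open>b y b\<close> and
    \<open>y b y\<close> reduce to \<open>a y a\<close> and \<open>y a y\<close> by cancelling
    \<open>k\<close> and \<open>k'\<close>.\<close>
  have abs: "a \<cdot> g = a" "g' \<cdot> a = a" "y \<cdot> g' = y" "g \<cdot> y = y" "b = k' \<cdot> (a \<cdot> k)"
    using c xy by (simp_all add: defs a b red)
  have ky: "g \<cdot> (k \<cdot> y) = y"
  proof -
    have "g \<cdot> (k \<cdot> y) = g \<cdot> (k \<cdot> g) \<cdot> y" using d c xy by (simp add: abs)
    then show ?thesis by (simp only: gkg abs)
  qed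
  have ka: "g' \<cdot> (k' \<cdot> a) = a"
  proof -
    have "g' \<cdot> (k' \<cdot> a) = g' \<cdot> (k' \<cdot> g') \<cdot> a" using d c xy by (simp add: abs)
    then show ?thesis by (simp only: gkg abs)
  qed
  have "b \<cdot> (y \<cdot> b) = k' \<cdot> (a \<cdot> k) \<cdot> (y \<cdot> (k' \<cdot> (a \<cdot> k)))" by (simp only: abs(5)[symmetric])
  also have "\<dots> = k' \<cdot> (a \<cdot> (k \<cdot> (y \<cdot> (k' \<cdot> a)))) \<cdot> k" using d c xy by simp
  also have "a \<cdot> (k \<cdot> (y \<cdot> (k' \<cdot> a))) = a \<cdot> g \<cdot> (k \<cdot> (y \<cdot> g' \<cdot> (k' \<cdot> a)))"
    by (simp only: abs(1,3))
  also have "\<dots> = a \<cdot> (g \<cdot> (k \<cdot> y)) \<cdot> (g' \<cdot> (k' \<cdot> a))" using d c xy by simp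
  also have "\<dots> = a" unfolding ky ka using c xy a by simp
  finally have 1: "b \<cdot> (y \<cdot> b) = b" using abs(5) c d by simp
  have "y \<cdot> (b \<cdot> y) = y \<cdot> (k' \<cdot> (a \<cdot> k) \<cdot> y)" by (simp only: abs(5)[symmetric])
  also have "\<dots> = y \<cdot> (k' \<cdot> (a \<cdot> (k \<cdot> y)))" using d c xy by simp
  also have "\<dots> = y \<cdot> g' \<cdot> (k' \<cdot> (a \<cdot> g \<cdot> (k \<cdot> y)))" by (simp only: abs(1,3))
  also have "\<dots> = y \<cdot> (g' \<cdot> (k' \<cdot> a)) \<cdot> (g \<cdot> (k \<cdot> y))" using d c xy by simp
  also have "\<dots> = y" unfolding ky ka using c xy a by simp
  finally show "y \<in> inverses S b" using 1 c xy by (simp add: inverses_iff)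
qed

text \<open>From here on a single common inverse certifies equality of the sets of inverses.\<close>

lemma Y_iff:
  "(a, b) \<in> rel_Y S \<longleftrightarrow> a \<in> carrier S \<and> b \<in> carrier S \<and> inverses S a \<inter> inverses S b \<noteq> {}"
proof
  assume "(a, b) \<in> rel_Y S"
  then show "a \<in> carrier S \<and> b \<in> carrier S \<and> inverses S a \<inter> inverses S b \<noteq> {}"
    using inv_in_inverses unfolding rel_Y_def by blast
next
  assume "a \<in> carrier S \<and> b \<in> carrier S \<and> inverses S a \<inter> inverses S b \<noteq> {}"
  then show "(a, b) \<in> rel_Y S"
    using inverses_common_subset unfolding rel_Y_def by blast
qed

lemma cong_Y: "sg_congruence S (rel_Y S)"
proof (rule congI)
  fix a b c assume ab: "(a, b) \<in> rel_Y S" and c: "c \<in> carrier S"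
  then obtain x where x: "a \<in> carrier S" "b \<in> carrier S" "x \<in> inverses S a" "x \<in> inverses S b"
    unfolding Y_iff by blast
  \<comment> \<open>Multiplying the common inverse \<open>x\<close> by \<open>\<iota> c\<close> on
    the opposite side keeps it common.\<close>
  have "x \<cdot> \<iota> c \<in> inverses S (c \<cdot> a)" "x \<cdot> \<iota> c \<in> inverses S (c \<cdot> b)"
    "\<iota> c \<cdot> x \<in> inverses S (a \<cdot> c)" "\<iota> c \<cdot> x \<in> inverses S (b \<cdot> c)"
    using inverses_mult x c inv_in_inverses[OF c] by simp_all
  then show "(c \<cdot> a, c \<cdot> b) \<in> rel_Y S \<and> (a \<cdot> c, b \<cdot> c) \<in> rel_Y S"
    unfolding Y_iff using x(1,2) c by blast
qed (auto simp: rel_Y_def)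

lemma Y_pure: "idempotent_pure S (rel_Y S)"
  by (rule idempotent_pureI[OF cong_Y]) (rule subset_Y_idem[OF subset_refl])

lemma Y_clifford: "clifford_congruence S (rel_Y S)"
  unfolding clifford_congruence_iff
proof (intro conjI ballI)
  fix e f assume ef: "e \<in> idems S" "f \<in> idems S"
  then have c: "e \<in> carrier S" "f \<in> carrier S" "e \<cdot> e = e" "f \<cdot> f = f"
    by (simp_all add: idems_iff)
  have red: "e \<cdot> (e \<cdot> z) = e \<cdot> z" "f \<cdot> (f \<cdot> z) = f \<cdot> z" if "z \<in> carrier S" for z
    using assoc[of e e z] assoc[of f f z] c that by simp_all
  \<comment> \<open>The common inverse of \<open>ef\<close> and \<open>fe\<close> is
    \<open>ef\<close> itself.\<close>
  have "e \<cdot> f \<in> inverses S (e \<cdot> f)" "e \<cdot> f \<in> inverses S (f \<cdot> e)"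
    using c by (simp_all add: inverses_iff red idem_alternating ef)
  then show "(e \<cdot> f, f \<cdot> e) \<in> rel_Y S" using c by (auto simp: Y_iff)
qed (rule cong_Y)

lemma nu_subset_Y: "nu S \<subseteq> rel_Y S"
  using nu_subset[OF Y_clifford] .

lemma nu_pure: "idempotent_pure S (nu S)"
  using idempotent_pure_mono[OF Y_pure cong_nu nu_subset_Y] .

lemma rectangular_idems:
  assumes "p \<in> idems S" "q \<in> idems S" "p \<sim> q"
  shows "p \<cdot> (q \<cdot> p) = p"
proof -
  have "p \<cdot> q \<cdot> p = p"
    using zero_product_left[OF assms(3)] idem_zero[OF idem_mult[OF assms(1,2)]] by simp
  then show ?thesis using assms by (simp add: idems_iff)
qed

text \<open>With \<open>g = \<zeta> (ab)\<close> and \<open>h = \<zeta> a \<cdot> \<zeta> b\<close>,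
  the product \<open>hg\<close> is evaluated twice: \<open>h\<close> fixes \<open>a\<close>, so
  \<open>hg = g\<close>; and \<open>g\<close> fixes \<open>b\<close> from the right, so
  \<open>hg = h\<close>.\<close>

lemma zero_mult_hom:
  assumes "a \<sim> b"
  shows "\<zeta> (a \<cdot> b) = \<zeta> a \<cdot> \<zeta> b"
proof -
  have c: "a \<in> carrier S" "b \<in> carrier S" using J_carrier[OF assms] by auto
  define g where "g = \<zeta> (a \<cdot> b)"
  define h where "h = \<zeta> a \<cdot> \<zeta> b"
  have gh: "g \<in> carrier S" "h \<in> carrier S" using c by (simp_all add: g_def h_def)
  have "g \<cdot> a = a" using zero_product_left[OF assms] by (simp add: g_def)
  then have "g \<cdot> \<zeta> a = \<zeta> a" using left_fix_zero gh c by simp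
  then have 1: "g \<cdot> h = h" using assoc[of g "\<zeta> a" "\<zeta> b"] gh c by (simp add: h_def)
  have "h \<in> idems S" unfolding h_def using idem_mult zero_idem c by simp
  moreover have "\<zeta> a \<sim> \<zeta> b"
    using J_trans[OF J_trans[OF J_zero assms] J_sym[OF J_zero]] c by simp
  ultimately have "h \<cdot> \<zeta> a = \<zeta> a" using zero_product_left idem_zero unfolding h_def by metis
  then have "h \<cdot> a = a" using assoc[of h "\<zeta> a" a] gh c by simp
  then have "h \<cdot> (a \<cdot> b) = a \<cdot> b" using assoc[of h a b] gh c by simp
  then have "h \<cdot> g = g" unfolding g_def using left_fix_zero gh c by simp
  moreover have "b \<cdot> g = b" using zero_product_right[OF assms] by (simp add: g_def)
  then have "\<zeta> b \<cdot> g = \<zeta> b" using right_fix_zero gh c by simp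
  then have "h \<cdot> g = h" using gh c by (simp add: h_def)
  ultimately show ?thesis by (simp add: g_def h_def)
qed

text \<open>If \<open>a\<close> and \<open>b\<close> are related on the left,
  \<open>\<iota> b\<close> is a common inverse, so they are related by \<open>rel_Y S\<close>, which
  lies below \<open>tau S\<close>.\<close>

lemma D_F_eq_D_tau: "green_D S \<inter> rel_F S = green_D S \<inter> tau S"
proof
  show "green_D S \<inter> tau S \<subseteq> green_D S \<inter> rel_F S"
    using idempotent_pure_subset_F[OF tau_pure] by blast
  show "green_D S \<inter> rel_F S \<subseteq> green_D S \<inter> tau S"
  proof (rule subrelI)
    fix a b assume ab: "(a, b) \<in> green_D S \<inter> rel_F S"
    then have "a \<in> carrier S" "b \<in> carrier S" "a \<sim> b" "a \<cdot> \<iota> b \<in> idems S"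
      by (simp_all add: rel_F_def green_D_iff)
    then have "(a, b) \<in> rel_Y S" using inv_mult_idem inv_in_inverses unfolding Y_iff by blast
    then show "(a, b) \<in> green_D S \<inter> tau S" using subset_tau[OF Y_pure] ab by blast
  qed
qed

text \<open>Multiplication by \<open>\<iota> b\<close> and by \<open>b\<close> exchanges the
  equation of \<open>rel_Theta\<close> with
  \<open>a \<cdot> \<iota> b = \<zeta> a \<cdot> \<zeta> b\<close>. Inside a
  \<open>\<D>\<close>-class the latter says that \<open>a \<cdot> \<iota> b\<close> is idempotent,
  by \<open>zero_mult_hom\<close>.\<close>

lemma D_Theta_eq_D_F: "green_D S \<inter> rel_Theta S = green_D S \<inter> rel_F S"
proof -
  have "(a, b) \<in> rel_Theta S \<longleftrightarrow> (a, b) \<in> rel_F S" if J: "a \<sim> b" for a b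
  proof -
    have c: "a \<in> carrier S" "b \<in> carrier S" using J_carrier[OF J] by auto
    have "a \<cdot> \<iota> b \<in> idems S" if T: "\<zeta> a \<cdot> b = a \<cdot> \<zeta> b"
    proof -
      have "\<zeta> a \<cdot> b \<cdot> \<iota> b = a \<cdot> \<zeta> b \<cdot> \<iota> b" using T by simp
      then have "\<zeta> a \<cdot> \<zeta> b = a \<cdot> \<iota> b" using c by simp
      then show ?thesis using idem_mult[OF zero_idem[OF c(1)] zero_idem[OF c(2)]] by simp
    qed
    moreover have "\<zeta> a \<cdot> b = a \<cdot> \<zeta> b" if F: "a \<cdot> \<iota> b \<in> idems S"
    proof -
      have "a \<sim> \<iota> b" using J_trans[OF J J_sym[OF J_inv[OF c(2)]]] .
      then have "a \<cdot> \<iota> b = \<zeta> a \<cdot> \<zeta> b"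
        using zero_mult_hom[of a "\<iota> b"] idem_zero[OF F] zero_inv[OF c(2)] by simp
      then have "a \<cdot> \<iota> b \<cdot> b = \<zeta> a \<cdot> \<zeta> b \<cdot> b" by simp
      then show ?thesis using c by simp
    qed
    ultimately show ?thesis using c unfolding rel_Theta_def rel_F_def by blast
  qed
  then show ?thesis using green_D_iff by auto
qed

text \<open>In a class closed under products \<open>a\<close> is related to
  \<open>a \<cdot> a\<close>, hence idempotent by purity. So \<open>a\<close> is an inverse of
  itself and therefore of each \<open>x\<close> in its class.\<close>

lemma nu_over_rectangular_bands: "over_rectangular_bands S (nu S)"
  unfolding over_rectangular_bands_def
proof (intro conjI ballI impI)
  fix A assume A: "A \<in> carrier S // nu S" and sub: "subsemigrp S A"
  have c: "A \<subseteq> carrier S" and sA: "semigrp (restr S A)"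
    using sub by (simp_all add: subsemigrp_def)
  have cl: "a \<cdot> a \<in> A" if "a \<in> A" for a using sA that by (simp add: semigrp_def)
  have eqv: "equiv (carrier S) (nu S)" using cong_nu by (simp add: sg_congruence_def)
  have rel: "(a, x) \<in> nu S" if "a \<in> A" "x \<in> A" for a x
    using quotient_eq_iff[OF eqv A A that] by simp
  have "a = a \<cdot> x \<cdot> a" if ax: "a \<in> A" "x \<in> A" for a x
  proof -
    have ac: "a \<in> carrier S" "x \<in> carrier S" using ax c by auto
    have "(a, \<zeta> a) \<in> nu S" using rel[OF cl[OF ax(1)] ax(1)] cong_zero[OF cong_nu ac(1)] by simp
    then have "a \<in> idems S" using idempotent_pureD[OF nu_pure _ zero_idem] ac by simp
    then have "a \<in> inverses S a" using ac by (simp add: inverses_iff idems_iff)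
    moreover have "inverses S a = inverses S x"
      using rel[OF ax] nu_subset_Y by (auto simp: rel_Y_def)
    ultimately have "a \<in> inverses S x" by simp
    then show ?thesis using ac by (simp add: inverses_iff)
  qed
  then show "rectangular_band (restr S A)" using sA by (simp add: rectangular_band_def)
qed (rule cong_nu)

text \<open>Coordinates: \<open>B\<close> is the band of idempotents of the class, \<open>G\<close>
  the maximal subgroup with identity \<open>e = \<zeta> a\<close>. An element \<open>s\<close>
  corresponds to \<open>(\<zeta> s, ese)\<close>, and \<open>(p, x)\<close> to
  \<open>pxp\<close>.\<close>

lemma rectangular_group_D_class:
  assumes a: "a \<in> carrier S"
  shows "rectangular_group (restr S (green_D S `` {a}))"
proof -
  define A where "A = green_D S `` {a}"
  define e where "e = \<zeta> a"
  have e: "e \<in> idems S" "e \<in> carrier S" "e \<cdot> e = e" using a by (simp_all add: e_def zero_idem)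
  have ea: "e \<sim> a" using J_zero[OF a] by (simp add: e_def)
  have A_iff: "s \<in> A \<longleftrightarrow> s \<sim> e" for s
  proof
    show "s \<sim> e" if "s \<in> A" using that J_sym[OF J_trans[OF ea, of s]] by (simp add: A_def green_D_iff)
    show "s \<in> A" if "s \<sim> e" using J_sym[OF J_trans[OF that ea]] by (simp add: A_def green_D_iff)
  qed
  have Ac: "s \<in> carrier S" if "s \<in> A" for s using that J_carrier by (simp add: A_iff)
  have AJ: "s \<sim> t" if "s \<in> A" "t \<in> A" for s t
    using that J_trans[OF _ J_sym] unfolding A_iff by blast
  have eA: "e \<in> A" using e by (simp add: A_iff J_refl)
  have A_mult: "s \<cdot> t \<in> A" if "s \<in> A" "t \<in> A" for s t
    using that J_mult[of s e t e] e by (simp add: A_iff)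
  have A_zero: "\<zeta> s \<in> A" if "s \<in> A" for s
    using that J_trans[OF J_zero[OF Ac[OF that]]] by (simp add: A_iff)
  have sub: "semigrp (restr S B)" if "B \<subseteq> A" "e \<in> B" "\<And>s t. s \<in> B \<Longrightarrow> t \<in> B \<Longrightarrow> s \<cdot> t \<in> B" for B
    using that Ac unfolding semigrp_def by (auto simp: subset_iff)
  define B where "B = idems S \<inter> A"
  define G where "G = {x \<in> carrier S. \<zeta> x = e}"
  have rect: "p \<cdot> (q \<cdot> p) = p" if "p \<in> B" "q \<in> B" for p q
    using rectangular_idems AJ that by (simp add: B_def)
  have eB: "e \<in> B" using e eA by (simp add: B_def)
  have Bc: "p \<in> carrier S" if "p \<in> B" for p using that by (simp add: B_def Ac)
  have B_mult: "p \<cdot> q \<in> B" if "p \<in> B" "q \<in> B" for p q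
    using that by (simp add: B_def A_mult idem_mult)
  have zB: "\<zeta> s \<in> B" if "s \<in> A" for s
    using that by (simp add: B_def A_zero zero_idem Ac)
  \<comment> \<open>A rectangular band ignores inner factors; this will split \<open>e s t e\<close>
    into \<open>ese\<close> and \<open>ete\<close>.\<close>
  have rect3: "p \<cdot> (e \<cdot> q) = p \<cdot> q" if "p \<in> B" "q \<in> B" for p q
  proof -
    have d: "p \<in> carrier S" "q \<in> carrier S" using Bc that by auto
    have "p \<cdot> (e \<cdot> q) = p \<cdot> (e \<cdot> (q \<cdot> (p \<cdot> q)))" by (simp only: rect[OF that(2,1)])
    also have "\<dots> = p \<cdot> (e \<cdot> q \<cdot> p) \<cdot> q" using d e by simp
    also have "\<dots> = p \<cdot> q" using rect[OF that(1) B_mult[OF eB that(2)]] by (simp only:)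
    finally show ?thesis .
  qed
  have GA: "x \<in> A" if "x \<in> G" for x
    using that J_sym[OF J_zero[of x]] by (simp add: G_def A_iff)
  have Gx: "x \<in> carrier S" "e \<cdot> x = x" "x \<cdot> e = x" if "x \<in> G" for x
    using that zero_mult[of x] mult_zero[of x] by (auto simp: G_def)
  have eG: "e \<in> G" using e idem_zero by (simp add: G_def)
  have G_mult: "x \<cdot> y \<in> G" if "x \<in> G" "y \<in> G" for x y
    using that zero_mult_hom[OF AJ[OF GA[OF that(1)] GA[OF that(2)]]] e by (simp add: G_def)
  have band: "rectangular_band (restr S B)"
    unfolding rectangular_band_def using sub[of B] eB B_mult rect Bc by (simp add: B_def)
  have group: "is_group (restr S G)"
  proof -
    have "\<exists>y\<in>G. y \<cdot> x = e" if "x \<in> G" for x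
      using that by (intro bexI[of _ "\<iota> x"]) (simp_all add: G_def zero_inv)
    moreover have "G \<subseteq> A" using GA by blast
    ultimately show ?thesis
      unfolding is_group_iff using sub[of G] eG G_mult Gx by (intro conjI bexI[of _ e]) auto
  qed
  have ese: "e \<cdot> (s \<cdot> e) \<in> G" if s: "s \<in> A" for s
  proof -
    have "\<zeta> (e \<cdot> (s \<cdot> e)) = \<zeta> e \<cdot> (\<zeta> s \<cdot> \<zeta> e)"
      using zero_mult_hom AJ eA s A_mult by simp
    also have "\<dots> = e" using rect[OF eB zB[OF s]] idem_zero[OF e(1)] by simp
    finally show ?thesis using e Ac[OF s] by (simp add: G_def)
  qed
  define f where "f s = (\<zeta> s, e \<cdot> (s \<cdot> e))" for s
  have "bij_betw f A (B \<times> G)"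
  \<comment> \<open>The maps are mutually inverse because
    \<open>\<zeta> s \<cdot> e \<cdot> \<zeta> s = \<zeta> s\<close> and
    \<open>epe = e\<close>.\<close>
  proof (rule bij_betw_byWitness[where f' = "\<lambda>(p, x). p \<cdot> (x \<cdot> p)"])
    show "\<forall>s\<in>A. (\<lambda>(p, x). p \<cdot> (x \<cdot> p)) (f s) = s"
    proof
      fix s assume s: "s \<in> A"
      have d: "s \<in> carrier S" using Ac s .
      have "\<zeta> s \<cdot> (e \<cdot> (s \<cdot> e) \<cdot> \<zeta> s) = \<zeta> s \<cdot> (e \<cdot> (\<zeta> s \<cdot> s \<cdot> \<zeta> s \<cdot> e) \<cdot> \<zeta> s)"
        using d e by simp
      also have "\<dots> = (\<zeta> s \<cdot> (e \<cdot> \<zeta> s)) \<cdot> s \<cdot> (\<zeta> s \<cdot> (e \<cdot> \<zeta> s))" using d e by simp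
      also have "\<dots> = s" unfolding rect[OF zB[OF s] eB] using d by simp
      finally show "(\<lambda>(p, x). p \<cdot> (x \<cdot> p)) (f s) = s" by (simp add: f_def)
    qed
    show "\<forall>y\<in>B \<times> G. f ((\<lambda>(p, x). p \<cdot> (x \<cdot> p)) y) = y"
    proof clarify
      fix p x assume px: "p \<in> B" "x \<in> G"
      have d: "p \<in> carrier S" "x \<in> carrier S" using Bc Gx px by auto
      have pA: "p \<in> A" "p \<in> idems S" using px by (simp_all add: B_def)
      have "\<zeta> (p \<cdot> (x \<cdot> p)) = \<zeta> p \<cdot> (\<zeta> x \<cdot> \<zeta> p)"
        using zero_mult_hom AJ pA GA[OF px(2)] A_mult by simp
      also have "\<dots> = p" using rect[OF px(1) eB] px idem_zero[OF pA(2)] by (simp add: G_def)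
      finally have 1: "\<zeta> (p \<cdot> (x \<cdot> p)) = p" .
      have "e \<cdot> (p \<cdot> (x \<cdot> p) \<cdot> e) = e \<cdot> (p \<cdot> ((e \<cdot> x \<cdot> e) \<cdot> p) \<cdot> e)" using Gx[OF px(2)] by simp
      also have "\<dots> = (e \<cdot> (p \<cdot> e)) \<cdot> x \<cdot> (e \<cdot> (p \<cdot> e))" using d e by simp
      also have "\<dots> = x" unfolding rect[OF eB px(1)] using Gx[OF px(2)] by simp
      finally show "f (p \<cdot> (x \<cdot> p)) = (p, x)" using 1 by (simp add: f_def)
    qed
    show "f ` A \<subseteq> B \<times> G" using zB ese by (auto simp: f_def)
    show "(\<lambda>(p, x). p \<cdot> (x \<cdot> p)) ` (B \<times> G) \<subseteq> A"
      using A_mult GA by (auto simp: B_def)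
  qed
  moreover have "f (s \<cdot> t) = f s \<cdot>\<^bsub>dir_prod (restr S B) (restr S G)\<^esub> f t" if st: "s \<in> A" "t \<in> A" for s t
  proof -
    have d: "s \<in> carrier S" "t \<in> carrier S" using Ac st by auto
    \<comment> \<open>\<open>\<zeta> s \<cdot> \<zeta> t\<close> is inserted between
      \<open>s\<close> and \<open>t\<close> to obtain a place where \<open>rect3\<close> can put
      \<open>e\<close>.\<close>
    have "e \<cdot> (s \<cdot> t \<cdot> e) = e \<cdot> (s \<cdot> (\<zeta> s \<cdot> \<zeta> t) \<cdot> t \<cdot> e)" using d e by simp
    also have "\<dots> = e \<cdot> (s \<cdot> (\<zeta> s \<cdot> (e \<cdot> \<zeta> t)) \<cdot> t \<cdot> e)"
      by (simp only: rect3[OF zB[OF st(1)] zB[OF st(2)]])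
    also have "\<dots> = e \<cdot> (s \<cdot> ((e \<cdot> e) \<cdot> (t \<cdot> e)))" using d e by simp
    also have "\<dots> = e \<cdot> (s \<cdot> e) \<cdot> (e \<cdot> (t \<cdot> e))" using d e(2) by simp
    finally show ?thesis using zero_mult_hom[OF AJ[OF st]] by (simp add: f_def dir_prod_def)
  qed
  moreover have "carrier (dir_prod (restr S B) (restr S G)) = B \<times> G" by (simp add: dir_prod_def)
  ultimately have "sg_iso f (restr S A) (dir_prod (restr S B) (restr S G))"
    by (simp add: sg_iso_def)
  moreover have "semigrp (restr S A)" using sub[of A] eA A_mult by simp
  ultimately show ?thesis using band group unfolding A_def[symmetric] by (intro rectangular_groupI)
qed

lemma semilattice_rectangular_groups: "semilattice_of_rectangular_groups S"
  unfolding semilattice_of_rectangular_groups_def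
proof (intro exI[of _ "green_D S"] conjI)
  show "semilattice_sg (quotient_sg S (green_D S))"
    unfolding semilattice_quotient_iff[OF cong_green_D] green_D_iff
    by (simp add: J_square J_swap)
  show "\<forall>A\<in>carrier S // green_D S. rectangular_group (restr S A)"
    unfolding ball_quotient by (simp add: rectangular_group_D_class)
qed (rule cong_green_D)

end

section \<open>Conditions that imply orthodoxy\<close>

context cr_sgr
begin

text \<open>An idempotent of the direct product has group component \<open>1\<close>, and every
  element of the band factor is idempotent; pairs of this kind are closed under products.\<close>

lemma rectangular_group_idem_mult:
  assumes rg: "rectangular_group (restr S A)" and A: "A \<subseteq> carrier S"
    and pq: "p \<in> A" "q \<in> A" "p \<in> idems S" "q \<in> idems S"
  shows "p \<cdot> q \<in> idems S"
proof -
  obtain B G :: "'a sgrp" and f where B: "rectangular_band B" and G: "is_group G"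
    and f: "sg_iso f (restr S A) (dir_prod B G)" and sA: "semigrp (restr S A)"
    using rg unfolding rectangular_group_def by blast
  interpret G: group "monoid_of G" using G by (simp add: is_group_def)
  have cl: "s \<cdot> t \<in> A" if "s \<in> A" "t \<in> A" for s t using sA that by (simp add: semigrp_def)
  have bij: "bij_betw f A (carrier B \<times> carrier G)"
    and hom: "\<And>s t. s \<in> A \<Longrightarrow> t \<in> A \<Longrightarrow> f (s \<cdot> t) = f s \<cdot>\<^bsub>dir_prod B G\<^esub> f t"
    using f by (simp_all add: sg_iso_def dir_prod_def)
  have fst: "fst (f s) \<in> carrier B" and snd: "snd (f s) \<in> carrier G" if "s \<in> A" for s
    using bij_betw_apply[OF bij that] by (simp_all add: mem_Times_iff)
  have hom1: "fst (f (s \<cdot> t)) = fst (f s) \<cdot>\<^bsub>B\<^esub> fst (f t)"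
    and hom2: "snd (f (s \<cdot> t)) = snd (f s) \<cdot>\<^bsub>G\<^esub> snd (f t)" if "s \<in> A" "t \<in> A" for s t
    using hom[OF that] by (simp_all add: dir_prod_def case_prod_beta)
  have c: "carrier (monoid_of G) = carrier G" and m: "mult (monoid_of G) = sg_mult G"
    by (simp_all add: monoid_of_def)
  have one: "snd (f s) = \<one>\<^bsub>monoid_of G\<^esub>" if "s \<in> A" "s \<in> idems S" for s
    using hom2[OF that(1,1)] snd[OF that(1)] that(2) G.r_cancel_one[of "snd (f s)" "snd (f s)"]
    unfolding c m by (simp add: idems_iff)
  have BI: "b \<cdot>\<^bsub>B\<^esub> b = b" if "b \<in> carrier B" for b
  proof -
    interpret B: sgr B using B by unfold_locales (simp add: rectangular_band_def)
    have b: "b = b \<cdot>\<^bsub>B\<^esub> x \<cdot>\<^bsub>B\<^esub> b" if "x \<in> carrier B" for x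
      using B \<open>b \<in> carrier B\<close> that by (simp add: rectangular_band_def)
    \<comment> \<open>Idempotency follows from \<open>b = b x b\<close> with \<open>x = bb\<close>
      and then \<open>x = b\<close>: the first gives \<open>b(bbb) = b\<close>, the second
      \<open>bbb = b\<close>.\<close>
    have "b \<cdot>\<^bsub>B\<^esub> (b \<cdot>\<^bsub>B\<^esub> b \<cdot>\<^bsub>B\<^esub> b) = b" using b[OF B.closed[OF that that]] that by simp
    then show ?thesis using b[OF that] by simp
  qed
  have pqA: "p \<cdot> q \<in> A" using cl pq by simp
  have "fst (f (p \<cdot> q \<cdot> (p \<cdot> q))) = fst (f (p \<cdot> q))"
    using hom1[OF pqA pqA] BI fst[OF pqA] by simp
  moreover have "snd (f (p \<cdot> q \<cdot> (p \<cdot> q))) = snd (f (p \<cdot> q))"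
  proof -
    have "snd (f (p \<cdot> q)) = \<one>\<^bsub>monoid_of G\<^esub>"
      using hom2[OF pq(1,2)] one pq G.l_one[OF G.one_closed] unfolding m by simp
    then show ?thesis using hom2[OF pqA pqA] G.l_one[OF G.one_closed] unfolding m by simp
  qed
  ultimately have "f (p \<cdot> q \<cdot> (p \<cdot> q)) = f (p \<cdot> q)" by (rule prod_eqI)
  then have "p \<cdot> q \<cdot> (p \<cdot> q) = p \<cdot> q"
    using bij cl[OF pqA pqA] pqA unfolding bij_betw_def by (meson inj_onD)
  then show ?thesis using pqA A unfolding idems_iff by blast
qed

lemma semilattice_rectangular_groups_orthodox:
  assumes "semilattice_of_rectangular_groups S"
  shows "orthodox S"
proof -
  obtain \<rho> where \<rho>: "sg_congruence S \<rho>" and sl: "semilattice_sg (quotient_sg S \<rho>)"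
    and rg: "\<And>a. a \<in> carrier S \<Longrightarrow> rectangular_group (restr S (\<rho> `` {a}))"
    using assms unfolding semilattice_of_rectangular_groups_def ball_quotient by blast
  show ?thesis
  proof (rule orthodoxI[OF \<rho>])
    fix a e f assume "a \<in> carrier S" "e \<in> idems S" "f \<in> idems S" "(a, e) \<in> \<rho>" "(a, f) \<in> \<rho>"
    moreover have "\<rho> `` {a} \<subseteq> carrier S" using cong_carrier[OF \<rho>] by blast
    ultimately show "e \<cdot> f \<in> idems S" using rectangular_group_idem_mult[OF rg] by simp
  qed (use sl semilattice_quotient_iff[OF \<rho>] in simp_all)
qed

text \<open>The common target of the converses for \<open>nu S\<close>: each condition is evaluated
  at the pair \<open>(a, \<zeta> a)\<close>.\<close>

lemma nu_idem_orthodox: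
  assumes "\<And>a. a \<in> carrier S \<Longrightarrow> (a, \<zeta> a) \<in> nu S \<Longrightarrow> a \<in> idems S"
  shows "orthodox S"
  using clifford_idempotent_pure_orthodox[OF nu_clifford] assms cong_carrier[OF cong_nu] by blast

text \<open>The class of an \<open>a\<close> related to \<open>\<zeta> a\<close> is a subsemigroup,
  hence a rectangular band, and its elements are idempotent.\<close>

lemma over_rectangular_bands_orthodox:
  assumes "over_rectangular_bands S (nu S)"
  shows "orthodox S"
proof (rule nu_idem_orthodox)
  fix a assume a: "a \<in> carrier S" and z: "(a, \<zeta> a) \<in> nu S"
  define A where "A = nu S `` {a}"
  have aa: "(a \<cdot> a, a) \<in> nu S" using z cong_zero[OF cong_nu a] by simp
  have "x \<cdot> y \<in> A" if "x \<in> A" "y \<in> A" for x y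
  proof -
    have "(a \<cdot> a, x \<cdot> y) \<in> nu S" using cong_mult[OF cong_nu, of a x a y] that by (simp add: A_def)
    then show ?thesis using cong_trans[OF cong_nu cong_sym[OF cong_nu aa]] by (simp add: A_def)
  qed
  moreover have aA: "a \<in> A" using cong_refl[OF cong_nu a] by (simp add: A_def)
  moreover have "A \<subseteq> carrier S" using cong_carrier[OF cong_nu] unfolding A_def by blast
  ultimately have "subsemigrp S A"
    unfolding subsemigrp_def semigrp_def by (auto simp: subset_iff)
  moreover have "A \<in> carrier S // nu S" using a by (simp add: A_def quotientI)
  ultimately have "rectangular_band (restr S A)"
    using assms by (simp add: over_rectangular_bands_def)
  then have rb: "x \<cdot> y \<cdot> x = x" if "x \<in> A" "y \<in> A" for x y
    using that by (simp add: rectangular_band_def)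
  have "a \<cdot> a \<in> A" using cong_sym[OF cong_nu aa] by (simp add: A_def)
  then have "a \<cdot> (a \<cdot> a \<cdot> a) = a" using rb[OF aA, of "a \<cdot> a"] a by simp
  then show "a \<in> idems S" using rb[OF aA aA] a unfolding idems_iff by simp
qed

lemma nu_H_orthodox:
  assumes "nu S \<inter> green_H S = eq_rel S"
  shows "orthodox S"
proof (rule nu_idem_orthodox)
  fix a assume a: "a \<in> carrier S" "(a, \<zeta> a) \<in> nu S"
  then have "(a, \<zeta> a) \<in> nu S \<inter> green_H S"
    using idem_zero[OF zero_idem] by (simp add: green_H_iff)
  then show "a \<in> idems S" unfolding assms using zero_idem[OF a(1)] by (auto simp: eq_rel_def)
qed

text \<open>If \<open>a\<close> and \<open>b\<close> lie in one subgroup, then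
  \<open>u = a \<cdot> \<iota> b\<close> does too. Purity makes \<open>u\<close> idempotent, so it
  is the identity \<open>\<zeta> b\<close> and \<open>a = u \<cdot> b = b\<close>.\<close>

lemma idempotent_pure_H:
  assumes \<rho>: "idempotent_pure S \<rho>"
  shows "\<rho> \<inter> green_H S = eq_rel S"
proof
  have c: "sg_congruence S \<rho>" using \<rho> by (simp add: idempotent_pure_def)
  show "eq_rel S \<subseteq> \<rho> \<inter> green_H S"
    using eq_rel_subset[OF c] by (auto simp: eq_rel_def green_H_iff)
  show "\<rho> \<inter> green_H S \<subseteq> eq_rel S"
  proof (rule subrelI)
    fix a b assume ab: "(a, b) \<in> \<rho> \<inter> green_H S"
    then have d: "a \<in> carrier S" "b \<in> carrier S" "\<zeta> a = \<zeta> b" by (simp_all add: green_H_iff)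
    define u where "u = a \<cdot> \<iota> b"
    have uS: "u \<in> carrier S" using d by (simp add: u_def)
    have "u \<in> idems S" using ab idempotent_pure_subset_F[OF \<rho>] by (auto simp: rel_F_def u_def)
    then have uu: "u \<cdot> u = u" by (simp add: idems_iff)
    have "a \<cdot> \<zeta> b = a" using mult_zero[OF d(1)] d(3) by simp
    then have ub: "u \<cdot> b = a" using d by (simp add: u_def)
    have "u \<cdot> a = a" using assoc[of u u b] uS d uu by (simp add: ub)
    then have "u \<cdot> \<zeta> b = \<zeta> b" using left_fix_zero[OF uS d(1)] d(3) by simp
    moreover have "u \<cdot> \<zeta> b = u" using mult_zero[of "\<iota> b"] d by (simp add: u_def)
    ultimately have "a = \<zeta> b \<cdot> b" using ub by simp
    then show "(a, b) \<in> eq_rel S" using d by (simp add: eq_rel_def Id_on_iff)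
  qed
qed

lemma nu_F_orthodox:
  assumes "nu S \<subseteq> rel_F S"
  shows "orthodox S"
proof (rule nu_idem_orthodox)
  fix a assume a: "a \<in> carrier S" "(a, \<zeta> a) \<in> nu S"
  then have "a \<cdot> \<iota> (\<zeta> a) \<in> idems S" using assms by (auto simp: rel_F_def)
  then show "a \<in> idems S" using idem_inv[OF zero_idem] a by simp
qed

lemma nu_pure_orthodox: "idempotent_pure S (nu S) \<Longrightarrow> orthodox S"
  using nu_idem_orthodox idempotent_pureD zero_idem by blast

end

theorem theorem3p10:
  fixes S :: "'a sgrp"
  assumes "completely_regular S"
  shows
   "(orthodox S \<longleftrightarrow> semilattice_of_rectangular_groups S) \<and>
    (orthodox S \<longleftrightarrow> green_D S \<inter> rel_F S = green_D S \<inter> tau S) \<and>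
    (orthodox S \<longleftrightarrow> sg_congruence S (green_D S \<inter> rel_F S)) \<and>
    (orthodox S \<longleftrightarrow> green_D S \<inter> rel_Theta S = green_D S \<inter> tau S) \<and>
    (orthodox S \<longleftrightarrow> sg_congruence S (green_D S \<inter> rel_Theta S)) \<and>
    (orthodox S \<longleftrightarrow> nu S \<subseteq> tau S) \<and>
    (orthodox S \<longleftrightarrow> nu S \<inter> green_H S = eq_rel S) \<and>
    (orthodox S \<longleftrightarrow> lower_k S (nu S) = eq_rel S) \<and>
    (orthodox S \<longleftrightarrow> (\<exists>\<rho>. idempotent_pure S \<rho> \<and> clifford_congruence S \<rho>)) \<and>
    (orthodox S \<longleftrightarrow> nu S \<subseteq> rel_F S) \<and>
    (orthodox S \<longleftrightarrow> over_rectangular_bands S (nu S)) \<and>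
    (orthodox S \<longleftrightarrow> nu S \<subseteq> rel_Y S)"
proof -
  interpret cr_sgr S
    using assms by unfold_locales (auto simp: completely_regular_def)
  have group: "orthogroup S" if "orthodox S" using that by unfold_locales
  note F = orthogroup.D_F_eq_D_tau[OF group]
  \<comment> \<open>Equality with \<open>green_D S \<inter> tau S\<close> makes the other
    intersection a congruence, which already implies orthodoxy.\<close>
  note cong = cong_Int[OF cong_green_D cong_tau]
  have pure: "orthodox S \<longleftrightarrow> idempotent_pure S (nu S)"
    using nu_pure_orthodox orthogroup.nu_pure[OF group] by blast
  have "orthodox S \<longleftrightarrow> semilattice_of_rectangular_groups S"
    using semilattice_rectangular_groups_orthodox
      orthogroup.semilattice_rectangular_groups[OF group] by blast
  moreover have "orthodox S \<longleftrightarrow> green_D S \<inter> rel_F S = green_D S \<inter> tau S"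
    "orthodox S \<longleftrightarrow> sg_congruence S (green_D S \<inter> rel_F S)"
    using F D_F_congruence_orthodox cong by auto
  moreover have "orthodox S \<longleftrightarrow> green_D S \<inter> rel_Theta S = green_D S \<inter> tau S"
    "orthodox S \<longleftrightarrow> sg_congruence S (green_D S \<inter> rel_Theta S)"
    using F orthogroup.D_Theta_eq_D_F[OF group] D_Theta_congruence_orthodox cong by auto
  moreover have "orthodox S \<longleftrightarrow> nu S \<subseteq> tau S"
    unfolding pure using subset_tau idempotent_pure_mono[OF tau_pure cong_nu] by blast
  moreover have "orthodox S \<longleftrightarrow> nu S \<inter> green_H S = eq_rel S"
    using nu_H_orthodox idempotent_pure_H pure by blast
  moreover have "orthodox S \<longleftrightarrow> lower_k S (nu S) = eq_rel S"
    unfolding pure using lower_k_eq_rel_iff[OF cong_nu] by simp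
  \<comment> \<open>Any witness \<open>\<rho>\<close> contains \<open>nu S\<close>, and purity
    passes to smaller congruences.\<close>
  moreover have "orthodox S \<longleftrightarrow> (\<exists>\<rho>. idempotent_pure S \<rho> \<and> clifford_congruence S \<rho>)"
    unfolding pure using idempotent_pure_mono[OF _ cong_nu nu_subset] nu_clifford by blast
  moreover have "orthodox S \<longleftrightarrow> nu S \<subseteq> rel_F S"
    using nu_F_orthodox idempotent_pure_subset_F pure by blast
  moreover have "orthodox S \<longleftrightarrow> over_rectangular_bands S (nu S)"
    using over_rectangular_bands_orthodox orthogroup.nu_over_rectangular_bands[OF group] by blast
  moreover have "orthodox S \<longleftrightarrow> nu S \<subseteq> rel_Y S"
    using nu_idem_orthodox subset_Y_idem orthogroup.nu_subset_Y[OF group] by blast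
  ultimately show ?thesis by (intro conjI)
qed

end
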